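(* Let $-\infty\le a<b\le\infty$, let $\kappa,\varphi:(a,b)\to\mathbb C$ be measurable with $\kappa\in L^2(a,b)$ and $\mathbb 1_{(a,c)}\varphi\in L^2(a,b)$ for every $c\in(a,b)$, and let $T$ be the integral operator in $L^2(a,b)$ given by $(Tf)(t)=\varphi(t)\int_t^b f(s)\overline{\kappa(s)}\,ds$ on its maximal domain. Choose $c_0:=a<c_1<c_2<\dots<b$ with $\|\mathbb 1_{(c_n,b)}\kappa\|^2=2^{-n}\|\kappa\|^2$, $n\in\mathbb N$, and set $J_n=(c_{n-1},c_n)$, $\omega_n=\|\mathbb 1_{J_n}\kappa\|\cdot\|\mathbb 1_{J_n}\varphi\|$. Then: $T$ compact $\Rightarrow$ $\operatorname{Re}T$ compact $\Rightarrow$ $\lim_{n\to\infty}\omega_n=0$ $\Rightarrow$ $T$ compact. In particular these three statements are equivalent.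
   Context: Norms $\|\cdot\|$ are those of $L^2(a,b)$; $\mathbb 1_E$ is the indicator function of $E$. $T$ is a closed, possibly unbounded operator; "compact" includes being bounded. *)

theory Defs
  imports "HOL-Analysis.Analysis"
begin

text \<open>Functions on (a,b) are modelled as total functions real \<Rightarrow> complex;
  only their values on the open interval matter. a, b are extended reals.\<close>

definition ivl :: "ereal \<Rightarrow> ereal \<Rightarrow> real set" where
  "ivl a b = {x. a < ereal x \<and> ereal x < b}"

definition L2 :: "ereal \<Rightarrow> ereal \<Rightarrow> (real \<Rightarrow> complex) set" where
  "L2 a b = {f. set_borel_measurable lborel (ivl a b) f \<and>
                 set_integrable lborel (ivl a b) (\<lambda>x. (cmod (f x))\<^sup>2)}"

definition L2norm :: "ereal \<Rightarrow> ereal \<Rightarrow> (real \<Rightarrow> complex) \<Rightarrow> real" where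
  "L2norm a b f = sqrt (LINT x:ivl a b|lborel. (cmod (f x))\<^sup>2)"

definition L2inner :: "ereal \<Rightarrow> ereal \<Rightarrow> (real \<Rightarrow> complex) \<Rightarrow> (real \<Rightarrow> complex) \<Rightarrow> complex" where
  "L2inner a b f g = (LINT x:ivl a b|lborel. f x * cnj (g x))"

definition Tfun :: "ereal \<Rightarrow> ereal \<Rightarrow> (real \<Rightarrow> complex) \<Rightarrow> (real \<Rightarrow> complex) \<Rightarrow> (real \<Rightarrow> complex) \<Rightarrow> (real \<Rightarrow> complex)" where
  "Tfun a b \<kappa> \<phi> f = (\<lambda>t. \<phi> t * (LINT s:{s. t < s \<and> ereal s < b}|lborel. f s * cnj (\<kappa> s)))"

definition T_graph :: "ereal \<Rightarrow> ereal \<Rightarrow> (real \<Rightarrow> complex) \<Rightarrow> (real \<Rightarrow> complex) \<Rightarrow> ((real \<Rightarrow> complex) \<times> (real \<Rightarrow> complex)) set" where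
  "T_graph a b \<kappa> \<phi> = {(f, Tfun a b \<kappa> \<phi> f) | f. f \<in> L2 a b \<and> Tfun a b \<kappa> \<phi> f \<in> L2 a b}"

definition adj_graph :: "ereal \<Rightarrow> ereal \<Rightarrow> ((real \<Rightarrow> complex) \<times> (real \<Rightarrow> complex)) set \<Rightarrow> ((real \<Rightarrow> complex) \<times> (real \<Rightarrow> complex)) set" where
  "adj_graph a b G = {(g, h). g \<in> L2 a b \<and> h \<in> L2 a b \<and>
      (\<forall>(f, u) \<in> G. L2inner a b u g = L2inner a b f h)}"

definition Re_graph :: "ereal \<Rightarrow> ereal \<Rightarrow> ((real \<Rightarrow> complex) \<times> (real \<Rightarrow> complex)) set \<Rightarrow> ((real \<Rightarrow> complex) \<times> (real \<Rightarrow> complex)) set" where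
  "Re_graph a b G = {(f, \<lambda>x. (u x + h x) / 2) | f u h. (f, u) \<in> G \<and> (f, h) \<in> adj_graph a b G}"

text \<open>Compactness (includes boundedness): every norm-bounded sequence in the domain has a
  subsequence whose images form a Cauchy (hence, L^2 being complete, convergent) sequence.\<close>
definition compact_op :: "ereal \<Rightarrow> ereal \<Rightarrow> ((real \<Rightarrow> complex) \<times> (real \<Rightarrow> complex)) set \<Rightarrow> bool" where
  "compact_op a b G \<longleftrightarrow> G \<subseteq> L2 a b \<times> L2 a b \<and>
     (\<forall>(f::nat \<Rightarrow> real \<Rightarrow> complex) (u::nat \<Rightarrow> real \<Rightarrow> complex) (B::real). (\<forall>n. (f n, u n) \<in> G \<and> L2norm a b (f n) \<le> B) \<longrightarrow>
        (\<exists>r::nat \<Rightarrow> nat. strict_mono r \<and>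
           (\<forall>e>(0::real). \<exists>N::nat. \<forall>m\<ge>N. \<forall>n\<ge>N. L2norm a b (\<lambda>x. u (r m) x - u (r n) x) < e)))"

end

theory Submission
  imports Defs "HOL-Complex_Analysis.Great_Picard"
begin

text \<open>Write \<open>E n\<close> for the interval \<open>(c n, c (n + 1))\<close>, which is \<open>J\<close> with index \<open>n + 1\<close> in the paper; the norms of
  \<open>\<kappa>\<close> and \<open>\<phi>\<close> on \<open>E n\<close> are \<open>kn n\<close> and \<open>pn n\<close>, so \<open>\<omega> (n + 1) = kn n * pn n\<close>.

  A bounded sequence in the range of the adjoint can be truncated to lie in the domain of \<open>T\<close>, up to an
  error tending to zero, so compactness of \<open>T\<close> passes to the adjoint and hence to the real part.

  The block of the real part that maps functions on \<open>E n\<close> to functions on \<open>E (n + 1)\<close> comes from the adjoint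
  alone. It has rank one, and its norm is comparable to \<open>\<omega>\<close> because the norm of \<open>\<kappa>\<close> on \<open>E n\<close> decays
  geometrically. Normalised restrictions of \<open>\<phi>\<close> to the \<open>E n\<close> have images that cannot accumulate unless
  \<open>\<omega>\<close> tends to zero.

  Conversely, a weighted Cauchy--Schwarz inequality bounds the part of \<open>T\<close> beyond \<open>c N\<close> by the
  supremum of \<open>\<omega> n\<close> over \<open>n > N\<close>, up to a constant. Before \<open>c N\<close> the function \<open>\<phi>\<close> is square
  integrable and the inner integrals of a bounded sequence are equicontinuous, so dominated convergence
  along a pointwise convergent subsequence gives compactness there.\<close>

section \<open>The space \<open>L\<^sup>2\<close> on an interval\<close>

lemma sets_ivl [measurable, simp]: "ivl a b \<in> sets borel"
  unfolding ivl_def by measurable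

lemma mem_ivl: "x \<in> ivl a b \<longleftrightarrow> a < ereal x \<and> ereal x < b"
  by (simp add: ivl_def)

lemma ivl_mono: "a \<le> c \<Longrightarrow> d \<le> b \<Longrightarrow> ivl c d \<subseteq> ivl a b"
  by (auto simp: ivl_def)

section \<open>Measurability of functions known only on a set\<close>

lemma set_borel_measurable_subset_borel:
  fixes f :: "real \<Rightarrow> 'a::{real_normed_vector,second_countable_topology}"
  assumes "set_borel_measurable lborel A f" "B \<in> sets borel" "B \<subseteq> A"
  shows "set_borel_measurable lborel B f"
proof -
  have [measurable]: "(\<lambda>x. indicator A x *\<^sub>R f x) \<in> borel_measurable borel" "B \<in> sets borel"
    using assms(1,2) by (auto simp: set_borel_measurable_def)
  have "(\<lambda>x. indicator B x *\<^sub>R (indicator A x *\<^sub>R f x)) \<in> borel_measurable borel"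
    by measurable
  moreover have "(\<lambda>x. indicator B x *\<^sub>R (indicator A x *\<^sub>R f x)) = (\<lambda>x. indicator B x *\<^sub>R f x)"
    using assms(3) by (auto simp: indicator_def fun_eq_iff)
  ultimately show ?thesis by (simp only: set_borel_measurable_def measurable_lborel2)
qed

lemma set_borel_measurable_compose:
  fixes f :: "real \<Rightarrow> complex" and g :: "complex \<Rightarrow> 'a::{real_normed_vector,second_countable_topology}"
  assumes "set_borel_measurable lborel A f" "A \<in> sets borel" "g \<in> borel_measurable borel"
  shows "set_borel_measurable lborel A (\<lambda>x. g (f x))"
proof -
  have [measurable]: "(\<lambda>x. indicator A x *\<^sub>R f x) \<in> borel_measurable borel" "A \<in> sets borel"
    "g \<in> borel_measurable borel"
    using assms by (auto simp: set_borel_measurable_def)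
  \<comment> \<open>The inner indicator makes the argument of \<open>g\<close> measurable on the
    whole line; the outer one removes the value \<open>g 0\<close> taken off
    \<open>A\<close>.\<close>
  have "(\<lambda>x. indicator A x *\<^sub>R g (indicator A x *\<^sub>R f x)) \<in> borel_measurable borel"
    by measurable
  moreover have "(\<lambda>x. indicator A x *\<^sub>R g (indicator A x *\<^sub>R f x)) = (\<lambda>x. indicator A x *\<^sub>R g (f x))"
    by (auto simp: indicator_def fun_eq_iff)
  ultimately show ?thesis by (simp only: set_borel_measurable_def measurable_lborel2)
qed

lemma set_borel_measurable_binop:
  fixes f g :: "real \<Rightarrow> complex" and h :: "complex \<Rightarrow> complex \<Rightarrow> 'a::{real_normed_vector,second_countable_topology}"
  assumes "set_borel_measurable lborel A f" "set_borel_measurable lborel A g" "A \<in> sets borel"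
    and "case_prod h \<in> borel_measurable (borel \<Otimes>\<^sub>M borel)"
  shows "set_borel_measurable lborel A (\<lambda>x. h (f x) (g x))"
proof -
  have [measurable]: "(\<lambda>x. indicator A x *\<^sub>R f x) \<in> borel_measurable borel"
    "(\<lambda>x. indicator A x *\<^sub>R g x) \<in> borel_measurable borel" "A \<in> sets borel"
    "case_prod h \<in> borel_measurable (borel \<Otimes>\<^sub>M borel)"
    using assms by (auto simp: set_borel_measurable_def)
  have "(\<lambda>x. case_prod h (indicator A x *\<^sub>R f x, indicator A x *\<^sub>R g x)) \<in> borel_measurable borel"
    by measurable
  then have "(\<lambda>x. indicator A x *\<^sub>R case_prod h (indicator A x *\<^sub>R f x, indicator A x *\<^sub>R g x)) \<in> borel_measurable borel"
    using assms(3) by (intro borel_measurable_scaleR) auto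
  moreover have "indicator A x *\<^sub>R case_prod h (indicator A x *\<^sub>R f x, indicator A x *\<^sub>R g x) = indicator A x *\<^sub>R h (f x) (g x)" for x
    by (auto simp: indicator_def)
  ultimately show ?thesis unfolding set_borel_measurable_def by (simp only: measurable_lborel2 measurable_lborel1)
qed

section \<open>The norm and the inner product\<close>

lemma L2_measurable: "f \<in> L2 a b \<Longrightarrow> set_borel_measurable lborel (ivl a b) f"
  and L2_square_integrable: "f \<in> L2 a b \<Longrightarrow> set_integrable lborel (ivl a b) (\<lambda>x. (cmod (f x))\<^sup>2)"
  by (auto simp: L2_def)

lemma L2norm_nonneg [simp]: "0 \<le> L2norm a b f"
  unfolding L2norm_def set_lebesgue_integral_def by simp

lemma L2norm_square: "(L2norm a b f)\<^sup>2 = (LINT x:ivl a b|lborel. (cmod (f x))\<^sup>2)"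
  unfolding L2norm_def set_lebesgue_integral_def by simp

lemma set_integrable_bound_borel:
  fixes f :: "real \<Rightarrow> 'a::{banach,second_countable_topology}" and g :: "real \<Rightarrow> real"
  assumes "set_integrable lborel A g" "set_borel_measurable lborel A f"
    "AE x in lborel. x \<in> A \<longrightarrow> norm (f x) \<le> g x"
  shows "set_integrable lborel A f"
  using assms by (intro set_integrable_bound[OF assms(1,2)]) auto

lemma L2_bound:
  assumes "g \<in> L2 a b" "set_borel_measurable lborel (ivl a b) f"
    "AE x in lborel. x \<in> ivl a b \<longrightarrow> cmod (f x) \<le> C * cmod (g x)"
  shows "f \<in> L2 a b"
proof -
  have "set_integrable lborel (ivl a b) (\<lambda>x. C\<^sup>2 * (cmod (g x))\<^sup>2)"
    using L2_square_integrable[OF assms(1)] by simp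
  then have "set_integrable lborel (ivl a b) (\<lambda>x. (cmod (f x))\<^sup>2)"
  proof (rule set_integrable_bound_borel)
    show "set_borel_measurable lborel (ivl a b) (\<lambda>x. (cmod (f x))\<^sup>2)"
      using assms(2) by (rule set_borel_measurable_compose) auto
    show "AE x in lborel. x \<in> ivl a b \<longrightarrow> norm ((cmod (f x))\<^sup>2) \<le> C\<^sup>2 * (cmod (g x))\<^sup>2"
      using assms(3) by eventually_elim
        (auto simp flip: power_mult_distrib intro!: power_mono)
  qed
  with assms(2) show ?thesis by (auto simp: L2_def)
qed

lemma L2norm_mono_AE:
  assumes "f \<in> L2 a b" "g \<in> L2 a b"
    "AE x in lborel. x \<in> ivl a b \<longrightarrow> cmod (f x) \<le> cmod (g x)"
  shows "L2norm a b f \<le> L2norm a b g"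
  unfolding L2norm_def real_sqrt_le_iff
  using assms by (intro set_integral_mono_AE L2_square_integrable) (auto elim!: eventually_mono intro!: power_mono)

lemma L2_add:
  assumes "f \<in> L2 a b" "g \<in> L2 a b"
  shows "(\<lambda>x. f x + g x) \<in> L2 a b"
proof -
  have m: "set_borel_measurable lborel (ivl a b) (\<lambda>x. f x + g x)"
    using assms by (intro set_borel_measurable_binop[where h="\<lambda>u v. u + v"] L2_measurable) auto
  have "set_integrable lborel (ivl a b) (\<lambda>x. 2 * (cmod (f x))\<^sup>2 + 2 * (cmod (g x))\<^sup>2)"
    using assms[THEN L2_square_integrable] by (intro set_integral_add) auto
  then have "set_integrable lborel (ivl a b) (\<lambda>x. (cmod (f x + g x))\<^sup>2)"
  proof (rule set_integrable_bound_borel)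
    show "set_borel_measurable lborel (ivl a b) (\<lambda>x. (cmod (f x + g x))\<^sup>2)"
      using m by (rule set_borel_measurable_compose) auto
    have "(cmod (f x + g x))\<^sup>2 \<le> 2 * (cmod (f x))\<^sup>2 + 2 * (cmod (g x))\<^sup>2" for x
      using power_mono[OF norm_triangle_ineq[of "f x" "g x"], of 2] sum_squares_bound[of "cmod (f x)" "cmod (g x)"]
      by (auto simp: power2_sum)
    then show "AE x in lborel. x \<in> ivl a b \<longrightarrow> norm ((cmod (f x + g x))\<^sup>2) \<le> 2 * (cmod (f x))\<^sup>2 + 2 * (cmod (g x))\<^sup>2"
      by simp
  qed
  with m show ?thesis by (auto simp: L2_def)
qed

lemma L2_mult_left:
  assumes "f \<in> L2 a b" shows "(\<lambda>x. k * f x) \<in> L2 a b"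
proof (rule L2_bound[OF assms])
  show "set_borel_measurable lborel (ivl a b) (\<lambda>x. k * f x)"
    using assms by (intro set_borel_measurable_compose[where g="\<lambda>z. k * z"] L2_measurable) auto
  show "AE x in lborel. x \<in> ivl a b \<longrightarrow> cmod (k * f x) \<le> cmod k * cmod (f x)"
    by (simp add: norm_mult)
qed

lemma L2_diff:
  assumes "f \<in> L2 a b" "g \<in> L2 a b"
  shows "(\<lambda>x. f x - g x) \<in> L2 a b"
  using L2_add[OF assms(1) L2_mult_left[OF assms(2), of "-1"]] by simp

lemma L2norm_mult_left: "L2norm a b (\<lambda>x. k * f x) = cmod k * L2norm a b f"
  unfolding L2norm_def by (simp add: norm_mult power_mult_distrib real_sqrt_mult)

lemma L2_norm_mult_integrable:
  assumes "f \<in> L2 a b" "g \<in> L2 a b"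
  shows "set_integrable lborel (ivl a b) (\<lambda>x. cmod (f x) * cmod (g x))"
proof -
  have "set_integrable lborel (ivl a b) (\<lambda>x. (cmod (f x))\<^sup>2 + (cmod (g x))\<^sup>2)"
    using assms[THEN L2_square_integrable] by (intro set_integral_add) auto
  then show ?thesis
  proof (rule set_integrable_bound_borel)
    show "set_borel_measurable lborel (ivl a b) (\<lambda>x. cmod (f x) * cmod (g x))"
      using assms by (intro set_borel_measurable_binop[where h="\<lambda>u v. cmod u * cmod v"] L2_measurable) auto
    have "cmod (f x) * cmod (g x) \<le> (cmod (f x))\<^sup>2 + (cmod (g x))\<^sup>2" for x
      using sum_squares_bound[of "cmod (f x)" "cmod (g x)"] mult_nonneg_nonneg[OF norm_ge_zero[of "f x"] norm_ge_zero[of "g x"]]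
      by linarith
    then show "AE x in lborel. x \<in> ivl a b \<longrightarrow> norm (cmod (f x) * cmod (g x)) \<le> (cmod (f x))\<^sup>2 + (cmod (g x))\<^sup>2"
      by (simp add: norm_mult)
  qed
qed

lemma L2_mult_cnj_integrable:
  assumes "f \<in> L2 a b" "g \<in> L2 a b"
  shows "set_integrable lborel (ivl a b) (\<lambda>x. f x * cnj (g x))"
  using L2_norm_mult_integrable[OF assms]
proof (rule set_integrable_bound_borel)
  show "set_borel_measurable lborel (ivl a b) (\<lambda>x. f x * cnj (g x))"
    using assms by (intro set_borel_measurable_binop[where h="\<lambda>u v. u * cnj v"] L2_measurable)
      (auto intro!: borel_measurable_continuous_onI continuous_intros simp: split_beta borel_prod)
qed (simp add: norm_mult)

text \<open>The integral of \<open>(y * cmod (f x) - cmod (g x))\<^sup>2\<close> is a nonnegative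
  quadratic polynomial in \<open>y\<close>, and a suitable \<open>y\<close> gives the bound. With
  the moduli under the integral it serves both \<open>L2inner_le\<close> and the triangle
  inequality.\<close>

lemma L2_Cauchy_Schwarz:
  assumes "f \<in> L2 a b" "g \<in> L2 a b"
  shows "(LINT x:ivl a b|lborel. cmod (f x) * cmod (g x)) \<le> L2norm a b f * L2norm a b g"
proof -
  define s where "s = L2norm a b f"
  define t where "t = L2norm a b g"
  define I where "I = (LINT x:ivl a b|lborel. cmod (f x) * cmod (g x))"
  have fi: "set_integrable lborel (ivl a b) (\<lambda>x. (cmod (f x))\<^sup>2)"
    "set_integrable lborel (ivl a b) (\<lambda>x. (cmod (g x))\<^sup>2)"
    "set_integrable lborel (ivl a b) (\<lambda>x. cmod (f x) * cmod (g x))"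
    using assms by (auto intro: L2_square_integrable L2_norm_mult_integrable)
  have q: "0 \<le> y\<^sup>2 * s\<^sup>2 - 2 * y * I + t\<^sup>2" for y
  proof -
    have "0 \<le> (LINT x:ivl a b|lborel. (y * cmod (f x) - cmod (g x))\<^sup>2)"
      by (simp add: set_lebesgue_integral_def)
    also have "\<dots> = (LINT x:ivl a b|lborel. y\<^sup>2 * (cmod (f x))\<^sup>2 - (2 * y) * (cmod (f x) * cmod (g x)) + (cmod (g x))\<^sup>2)"
      by (intro set_lebesgue_integral_cong) (auto simp: power2_eq_square algebra_simps)
    also have "\<dots> = y\<^sup>2 * s\<^sup>2 - 2 * y * I + t\<^sup>2"
      using fi by (simp add: set_integral_add set_integral_diff s_def t_def I_def L2norm_square)
    finally show ?thesis .
  qed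
  have nn: "0 \<le> s" "0 \<le> t" by (auto simp: s_def t_def)
  have "I \<le> s * t"
  proof (cases "s = 0")
    case True
    show ?thesis
    proof (rule ccontr)
      assume "\<not> I \<le> s * t"
      then have "I > 0" using True by simp
      \<comment> \<open>With \<open>s = 0\<close> the polynomial is linear in \<open>y\<close>, and
        this choice gives it the value \<open>-1\<close>.\<close>
      with q[of "(t\<^sup>2 + 1) / (2 * I)"] True show False by simp
    qed
  next
    case False
    then have "s > 0" using nn by simp
    \<comment> \<open>The ratio of the norms makes both square terms equal to
      \<open>t\<^sup>2\<close>; cancelling \<open>t\<close> afterwards requires that it is
      nonzero.\<close>
    from q[of "t / s"] have "2 * (t / s) * I \<le> 2 * t\<^sup>2" using \<open>s > 0\<close> by (simp add: power_divide)
    then have *: "t * I \<le> s * t\<^sup>2" using \<open>s > 0\<close> by (simp add: field_simps)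
    show ?thesis
    proof (cases "t = 0")
      case True
      show ?thesis
      proof (rule ccontr)
        assume "\<not> I \<le> s * t"
        then have "I > 0" using True by simp
        \<comment> \<open>For \<open>t = 0\<close> the vertex of the parabola gives the value
          \<open>-(I / s)\<^sup>2\<close>.\<close>
        from q[of "I / s\<^sup>2"] True \<open>s > 0\<close> have "I * I \<le> 0"
          by (simp add: power2_eq_square field_simps)
        with \<open>I > 0\<close> show False using mult_pos_pos[of I I] by linarith
      qed
    next
      case False
      with nn have "t > 0" by simp
      with * show ?thesis by (simp add: power2_eq_square)
    qed
  qed
  then show ?thesis by (simp add: s_def t_def I_def)
qed

lemma L2inner_le:
  assumes "f \<in> L2 a b" "g \<in> L2 a b"
  shows "cmod (L2inner a b f g) \<le> L2norm a b f * L2norm a b g"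
proof -
  have "cmod (L2inner a b f g) \<le> (LINT x:ivl a b|lborel. cmod (f x * cnj (g x)))"
    unfolding L2inner_def by (rule set_integral_norm_bound[OF L2_mult_cnj_integrable[OF assms]])
  then show ?thesis using L2_Cauchy_Schwarz[OF assms] by (simp add: norm_mult)
qed

lemma L2norm_triangle:
  assumes "f \<in> L2 a b" "g \<in> L2 a b"
  shows "L2norm a b (\<lambda>x. f x + g x) \<le> L2norm a b f + L2norm a b g"
proof (rule power2_le_imp_le)
  have fi: "set_integrable lborel (ivl a b) (\<lambda>x. (cmod (f x))\<^sup>2)"
    "set_integrable lborel (ivl a b) (\<lambda>x. (cmod (g x))\<^sup>2)"
    "set_integrable lborel (ivl a b) (\<lambda>x. cmod (f x) * cmod (g x))"
    using assms by (auto intro: L2_square_integrable L2_norm_mult_integrable)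
  have "(L2norm a b (\<lambda>x. f x + g x))\<^sup>2 = (LINT x:ivl a b|lborel. (cmod (f x + g x))\<^sup>2)"
    by (rule L2norm_square)
  also have "\<dots> \<le> (LINT x:ivl a b|lborel. (cmod (f x))\<^sup>2 + 2 * (cmod (f x) * cmod (g x)) + (cmod (g x))\<^sup>2)"
  proof (intro set_integral_mono)
    show "set_integrable lborel (ivl a b) (\<lambda>x. (cmod (f x + g x))\<^sup>2)"
      using L2_square_integrable[OF L2_add[OF assms]] .
    show "set_integrable lborel (ivl a b) (\<lambda>x. (cmod (f x))\<^sup>2 + 2 * (cmod (f x) * cmod (g x)) + (cmod (g x))\<^sup>2)"
      using fi by (intro set_integral_add) auto
    fix x
    show "(cmod (f x + g x))\<^sup>2 \<le> (cmod (f x))\<^sup>2 + 2 * (cmod (f x) * cmod (g x)) + (cmod (g x))\<^sup>2"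
      using power_mono[OF norm_triangle_ineq[of "f x" "g x"], of 2] by (auto simp: power2_sum)
  qed
  also have "\<dots> = (L2norm a b f)\<^sup>2 + 2 * (LINT x:ivl a b|lborel. cmod (f x) * cmod (g x)) + (L2norm a b g)\<^sup>2"
    using fi by (simp add: set_integral_add L2norm_square)
  also have "\<dots> \<le> (L2norm a b f + L2norm a b g)\<^sup>2"
    using L2_Cauchy_Schwarz[OF assms] by (simp add: power2_sum)
  finally show "(L2norm a b (\<lambda>x. f x + g x))\<^sup>2 \<le> (L2norm a b f + L2norm a b g)\<^sup>2" .
qed simp

lemma L2norm_triangle_diff:
  assumes "f \<in> L2 a b" "g \<in> L2 a b"
  shows "L2norm a b (\<lambda>x. f x - g x) \<le> L2norm a b f + L2norm a b g"
  using L2norm_triangle[OF assms(1) L2_mult_left[OF assms(2), of "-1"]] L2norm_mult_left[of a b "-1" g] by simp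

section \<open>Restriction to subintervals and cut-off functions\<close>

lemma L2_subinterval:
  assumes "f \<in> L2 a b" "a \<le> c" "d \<le> b"
  shows "f \<in> L2 c d"
proof -
  have "set_integrable lborel (ivl c d) (\<lambda>x. (cmod (f x))\<^sup>2)"
    using L2_square_integrable[OF assms(1)] by (rule set_integrable_subset) (use ivl_mono assms in auto)
  moreover have "set_borel_measurable lborel (ivl c d) f"
    using L2_measurable[OF assms(1)] by (rule set_borel_measurable_subset_borel) (use ivl_mono assms in auto)
  ultimately show ?thesis by (simp add: L2_def)
qed

lemma L2norm_subinterval:
  assumes "f \<in> L2 a b" "a \<le> c" "d \<le> b"
  shows "L2norm c d f \<le> L2norm a b f"
  unfolding L2norm_def real_sqrt_le_iff set_lebesgue_integral_def
  using L2_square_integrable[OF assms(1)] L2_square_integrable[OF L2_subinterval[OF assms]] ivl_mono[OF assms(2,3)]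
  by (intro integral_mono) (auto simp: set_integrable_def indicator_def)

lemma L2_indicator:
  assumes "f \<in> L2 a b" "A \<in> sets borel"
  shows "(\<lambda>x. indicator A x * f x) \<in> L2 a b"
proof (rule L2_bound[OF assms(1), where C=1])
  have [measurable]: "(\<lambda>x. indicator (ivl a b) x *\<^sub>R f x) \<in> borel_measurable borel" "A \<in> sets borel"
    using L2_measurable[OF assms(1)] assms(2) by (auto simp: set_borel_measurable_def)
  have "(\<lambda>x. indicator A x * (indicator (ivl a b) x *\<^sub>R f x)) \<in> borel_measurable borel" by measurable
  then show "set_borel_measurable lborel (ivl a b) (\<lambda>x. indicator A x * f x)"
    by (simp add: set_borel_measurable_def)
qed (auto simp: indicator_def)

text \<open>Passes between a cut-off on \<open>(a,b)\<close> and a restriction to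
  \<open>(c,d)\<close>. The set \<open>A\<close> is compared with the subinterval only inside
  \<open>ivl a b\<close>, so a half-line can serve as cut-off.\<close>

lemma L2_indicator_iff:
  assumes "ivl c d \<subseteq> ivl a b" "\<And>x. x \<in> ivl a b \<Longrightarrow> x \<in> A \<longleftrightarrow> x \<in> ivl c d"
  shows "(\<lambda>x. indicator A x * f x) \<in> L2 a b \<longleftrightarrow> f \<in> L2 c d"
proof -
  have "indicator (ivl a b) x *\<^sub>R (indicator A x * f x) = indicator (ivl c d) x *\<^sub>R f x"
    "indicator (ivl a b) x *\<^sub>R (cmod (indicator A x * f x))\<^sup>2 = indicator (ivl c d) x *\<^sub>R (cmod (f x))\<^sup>2" for x
    using assms by (auto simp: indicator_def norm_mult)
  then show ?thesis unfolding L2_def set_borel_measurable_def set_integrable_def by simp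
qed

lemma L2norm_indicator:
  assumes "ivl c d \<subseteq> ivl a b" "\<And>x. x \<in> ivl a b \<Longrightarrow> x \<in> A \<longleftrightarrow> x \<in> ivl c d"
  shows "L2norm a b (\<lambda>x. indicator A x * f x) = L2norm c d f"
proof -
  have "indicator (ivl a b) x *\<^sub>R (cmod (indicator A x * f x))\<^sup>2 = indicator (ivl c d) x *\<^sub>R (cmod (f x))\<^sup>2" for x
    using assms by (auto simp: indicator_def norm_mult)
  then show ?thesis unfolding L2norm_def set_lebesgue_integral_def by simp
qed

text \<open>The two open parts miss at most the point \<open>d\<close>, a null set.\<close>

lemma set_integral_ivl_split:
  fixes f :: "real \<Rightarrow> 'a::{banach,second_countable_topology}"
  assumes f: "set_integrable lborel (ivl a b) f" and d: "a \<le> ereal d" "ereal d \<le> b"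
  shows "(LINT x:ivl a b|lborel. f x) = (LINT x:ivl a d|lborel. f x) + (LINT x:ivl d b|lborel. f x)"
proof -
  have sub: "ivl a d \<subseteq> ivl a b" "ivl d b \<subseteq> ivl a b" using d ivl_mono[of a a "ereal d" b] ivl_mono[of a "ereal d" b b] by auto
  have "(LINT x:ivl a b|lborel. f x) = (LINT x:ivl a d \<union> ivl d b|lborel. f x)"
    unfolding set_lebesgue_integral_def
  proof (rule integral_cong_AE)
    show "AE x in lborel. indicator (ivl a b) x *\<^sub>R f x = indicator (ivl a d \<union> ivl d b) x *\<^sub>R f x"
      using AE_lborel_singleton[of d]
    proof eventually_elim
      case (elim x)
      have "x \<in> ivl a b \<longleftrightarrow> x \<in> ivl a d \<union> ivl d b"
        using elim d by (cases a; cases b) (auto simp: mem_ivl)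
      then show ?case by (simp add: indicator_def)
    qed
    have "set_integrable lborel (ivl a d \<union> ivl d b) f"
      using f by (rule set_integrable_subset) (use sub in auto)
    then show "(\<lambda>x. indicator (ivl a d \<union> ivl d b) x *\<^sub>R f x) \<in> borel_measurable lborel"
      by (simp add: set_integrable_def)
    show "(\<lambda>x. indicator (ivl a b) x *\<^sub>R f x) \<in> borel_measurable lborel"
      using f by (simp add: set_integrable_def)
  qed
  also have "\<dots> = (LINT x:ivl a d|lborel. f x) + (LINT x:ivl d b|lborel. f x)"
    using f sub by (intro set_integral_Un) (auto simp: mem_ivl intro: set_integrable_subset)
  finally show ?thesis .
qed

lemma L2norm_split:
  assumes "f \<in> L2 a b" "a \<le> ereal d" "ereal d \<le> b"
  shows "(L2norm a b f)\<^sup>2 = (L2norm a d f)\<^sup>2 + (L2norm d b f)\<^sup>2"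
  unfolding L2norm_square by (rule set_integral_ivl_split[OF L2_square_integrable[OF assms(1)] assms(2,3)])

lemma L2norm_dominated_convergence:
  assumes h: "h \<in> L2 a b" and g: "\<And>n. g n \<in> L2 a b"
    and le: "\<And>n x. x \<in> ivl a b \<Longrightarrow> cmod (g n x) \<le> C * cmod (h x)"
    and lim: "\<And>x. x \<in> ivl a b \<Longrightarrow> (\<lambda>n. g n x) \<longlonglongrightarrow> 0"
  shows "(\<lambda>n. L2norm a b (g n)) \<longlonglongrightarrow> 0"
proof -
  have "(\<lambda>n. LINT x|lborel. indicator (ivl a b) x *\<^sub>R (cmod (g n x))\<^sup>2) \<longlonglongrightarrow> (LINT (x::real)|lborel. (0::real))"
  proof (rule Bochner_Integration.integral_dominated_convergence[where w="\<lambda>x. indicator (ivl a b) x *\<^sub>R (C\<^sup>2 * (cmod (h x))\<^sup>2)"])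
    show "integrable lborel (\<lambda>x. indicator (ivl a b) x *\<^sub>R (C\<^sup>2 * (cmod (h x))\<^sup>2))"
      using L2_square_integrable[OF h] unfolding set_integrable_def[symmetric] by simp
    show "(\<lambda>x. indicator (ivl a b) x *\<^sub>R (cmod (g n x))\<^sup>2) \<in> borel_measurable lborel" for n
      using L2_square_integrable[OF g] by (simp add: set_integrable_def)
    have "(\<lambda>n. indicator (ivl a b) x *\<^sub>R (cmod (g n x))\<^sup>2) \<longlonglongrightarrow> 0" for x
    proof (cases "x \<in> ivl a b")
      case True
      from tendsto_power[OF tendsto_norm[OF lim[OF True]], of 2] show ?thesis by (simp add: True)
    qed simp
    then show "AE x in lborel. (\<lambda>n. indicator (ivl a b) x *\<^sub>R (cmod (g n x))\<^sup>2) \<longlonglongrightarrow> 0" by simp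
    show "AE x in lborel. norm (indicator (ivl a b) x *\<^sub>R (cmod (g n x))\<^sup>2) \<le> indicator (ivl a b) x *\<^sub>R (C\<^sup>2 * (cmod (h x))\<^sup>2)" for n
      using le[of _ n] by (auto simp: indicator_def simp flip: power_mult_distrib intro!: power_mono)
  qed auto
  from tendsto_real_sqrt[OF this] show ?thesis
    by (simp add: L2norm_def set_lebesgue_integral_def)
qed

text \<open>Dominated convergence with \<open>h\<close> itself as majorant. It serves the tails near
  \<open>b\<close>, the blocks \<open>E n\<close> that move off, and the intervals shrinking to a
  point from the right.\<close>

lemma L2norm_indicator_tendsto_0:
  assumes h: "h \<in> L2 a b" and A: "\<And>n. A n \<in> sets borel"
    and ev: "\<And>x. x \<in> ivl a b \<Longrightarrow> eventually (\<lambda>n. x \<notin> A n) sequentially"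
  shows "(\<lambda>n. L2norm a b (\<lambda>x. indicator (A n) x * h x)) \<longlonglongrightarrow> 0"
proof (rule L2norm_dominated_convergence[OF h, where C=1])
  show "(\<lambda>n. indicator (A n) x * h x) \<longlonglongrightarrow> 0" if "x \<in> ivl a b" for x
    by (rule tendsto_eventually) (use ev[OF that] in eventually_elim, simp)
  show "(\<lambda>x. indicator (A n) x * h x) \<in> L2 a b" for n
    by (rule L2_indicator[OF h A])
qed (auto simp: norm_mult indicator_def)

section \<open>The integral operator and its adjoint\<close>

lemma L2norm_cong:
  assumes "\<And>x. x \<in> ivl a b \<Longrightarrow> f x = g x"
  shows "L2norm a b f = L2norm a b g"
  unfolding L2norm_def using assms by (auto intro!: arg_cong[where f=sqrt] set_lebesgue_integral_cong)

lemma L2_cong: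
  assumes "\<And>x. x \<in> ivl a b \<Longrightarrow> f x = g x"
  shows "f \<in> L2 a b \<longleftrightarrow> g \<in> L2 a b"
proof -
  have "(\<lambda>x. indicat_real (ivl a b) x *\<^sub>R f x) = (\<lambda>x. indicat_real (ivl a b) x *\<^sub>R g x)"
    "(\<lambda>x. indicat_real (ivl a b) x *\<^sub>R (cmod (f x))\<^sup>2) = (\<lambda>x. indicat_real (ivl a b) x *\<^sub>R (cmod (g x))\<^sup>2)"
    using assms by (auto simp: indicator_def fun_eq_iff)
  then show ?thesis by (simp only: L2_def set_borel_measurable_def set_integrable_def mem_Collect_eq)
qed

lemma L2inner_cong:
  assumes "\<And>x. x \<in> ivl a b \<Longrightarrow> f x * cnj (g x) = f' x * cnj (g' x)"
  shows "L2inner a b f g = L2inner a b f' g'"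
  unfolding L2inner_def using assms by (auto intro!: set_lebesgue_integral_cong)

lemma L2inner_diff_left:
  assumes "f \<in> L2 a b" "g \<in> L2 a b" "h \<in> L2 a b"
  shows "L2inner a b (\<lambda>x. f x - g x) h = L2inner a b f h - L2inner a b g h"
  unfolding L2inner_def left_diff_distrib
  by (rule set_integral_diff(2)) (use assms in \<open>auto intro: L2_mult_cnj_integrable\<close>)

lemma L2inner_diff_right:
  assumes "f \<in> L2 a b" "g \<in> L2 a b" "h \<in> L2 a b"
  shows "L2inner a b h (\<lambda>x. f x - g x) = L2inner a b h f - L2inner a b h g"
  unfolding L2inner_def complex_cnj_diff right_diff_distrib
  by (rule set_integral_diff(2)) (use assms in \<open>auto intro: L2_mult_cnj_integrable\<close>)

lemma L2inner_mult_left: "L2inner a b (\<lambda>x. k * f x) h = k * L2inner a b f h"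
  unfolding L2inner_def by (simp add: mult.assoc)

lemma L2inner_self:
  assumes "f \<in> L2 a b"
  shows "L2inner a b f f = of_real ((L2norm a b f)\<^sup>2)"
proof -
  have "L2inner a b f f = (LINT x:ivl a b|lborel. complex_of_real ((cmod (f x))\<^sup>2))"
    unfolding L2inner_def by (intro set_lebesgue_integral_cong) (simp_all del: of_real_power add: complex_norm_square)
  also have "\<dots> = of_real (LINT x:ivl a b|lborel. (cmod (f x))\<^sup>2)"
    by (rule set_integral_complex_of_real)
  finally show ?thesis by (simp add: L2norm_square)
qed

text \<open>As an inner product with \<kappa> over \<open>(t,b)\<close>, the inner integral is open
  to Cauchy--Schwarz.\<close>

lemma Tfun_eq: "Tfun a b \<kappa> \<phi> f t = \<phi> t * L2inner (ereal t) b f \<kappa>"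
  by (simp add: Tfun_def L2inner_def ivl_def)

lemma Tfun_mult: "Tfun a b \<kappa> \<phi> (\<lambda>x. k * f x) = (\<lambda>t. k * Tfun a b \<kappa> \<phi> f t)"
  by (simp add: Tfun_eq L2inner_mult_left fun_eq_iff)

lemma Tfun_diff:
  assumes "f \<in> L2 a b" "g \<in> L2 a b" "\<kappa> \<in> L2 a b" "t \<in> ivl a b"
  shows "Tfun a b \<kappa> \<phi> (\<lambda>x. f x - g x) t = Tfun a b \<kappa> \<phi> f t - Tfun a b \<kappa> \<phi> g t"
  using assms unfolding Tfun_eq
  by (subst L2inner_diff_left) (auto intro: L2_subinterval[of _ a b] simp: mem_ivl right_diff_distrib)

lemma mem_T_graph:
  "(f, u) \<in> T_graph a b \<kappa> \<phi> \<longleftrightarrow> f \<in> L2 a b \<and> u \<in> L2 a b \<and> u = Tfun a b \<kappa> \<phi> f"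
  by (auto simp: T_graph_def)

section \<open>Integrals with a variable endpoint\<close>

lemma mem_ivl_cut:
  assumes "t \<in> ivl a b"
  shows "x \<in> ivl (ereal t) b \<longleftrightarrow> x \<in> ivl a b \<and> t < x"
    and "x \<in> ivl a (ereal t) \<longleftrightarrow> x \<in> ivl a b \<and> x < t"
  using assms by (cases a; cases b; auto simp: mem_ivl)+

text \<open>The variable endpoint moves into an indicator over the whole line, where measurability
  of parameter integrals and Fubini's theorem apply.\<close>

lemma L2inner_cut_eq:
  "t \<in> ivl a b \<Longrightarrow> L2inner (ereal t) b f g
    = (LINT s|lborel. indicator {t<..} s *\<^sub>R (indicator (ivl a b) s *\<^sub>R (f s * cnj (g s))))"
  "t \<in> ivl a b \<Longrightarrow> L2inner a (ereal t) f g
    = (LINT s|lborel. indicator {..<t} s *\<^sub>R (indicator (ivl a b) s *\<^sub>R (f s * cnj (g s))))"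
  unfolding L2inner_def set_lebesgue_integral_def
  by (intro Bochner_Integration.integral_cong refl; auto simp: indicator_def mem_ivl_cut)+

lemma half_line_integral_measurable:
  fixes B :: "real \<Rightarrow> complex"
  assumes [measurable]: "B \<in> borel_measurable borel"
  shows "(\<lambda>t. LINT s|lborel. indicator {t<..} s *\<^sub>R B s) \<in> borel_measurable borel"
    and "(\<lambda>t. LINT s|lborel. indicator {..<t} s *\<^sub>R B s) \<in> borel_measurable borel"
proof -
  have "(\<lambda>(t, s). (if t < s then 1 else 0) *\<^sub>R B s) \<in> borel_measurable (borel \<Otimes>\<^sub>M lborel)"
    "(\<lambda>(t, s). (if s < t then 1 else 0) *\<^sub>R B s) \<in> borel_measurable (borel \<Otimes>\<^sub>M lborel)"
    by measurable
  from this[THEN lborel.borel_measurable_lebesgue_integral]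
  show "(\<lambda>t. LINT s|lborel. indicator {t<..} s *\<^sub>R B s) \<in> borel_measurable borel"
    "(\<lambda>t. LINT s|lborel. indicator {..<t} s *\<^sub>R B s) \<in> borel_measurable borel"
    by (simp_all add: indicator_def of_bool_def)
qed

text \<open>With \<open>k\<close> taken as \<phi> and as \<kappa> respectively, the two claims give
  measurability of images under the operator and under its adjoint.\<close>

lemma set_borel_measurable_mult_cut:
  assumes f: "f \<in> L2 a b" and g: "g \<in> L2 a b" and k: "set_borel_measurable lborel (ivl a b) k"
  shows "set_borel_measurable lborel (ivl a b) (\<lambda>t. k t * L2inner (ereal t) b f g)"
    and "set_borel_measurable lborel (ivl a b) (\<lambda>t. k t * L2inner a (ereal t) f g)"
proof -
  have B: "(\<lambda>s. indicator (ivl a b) s *\<^sub>R (f s * cnj (g s))) \<in> borel_measurable borel"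
    using L2_mult_cnj_integrable[OF f g] by (auto simp: set_integrable_def dest: borel_measurable_integrable)
  note [measurable] = half_line_integral_measurable[OF B]
  have [measurable]: "(\<lambda>x. indicat_real (ivl a b) x *\<^sub>R k x) \<in> borel_measurable borel"
    using k by (simp add: set_borel_measurable_def)
  have "(\<lambda>t. (indicat_real (ivl a b) t *\<^sub>R k t) *
      (LINT s|lborel. indicator {t<..} s *\<^sub>R (indicator (ivl a b) s *\<^sub>R (f s * cnj (g s))))) \<in> borel_measurable borel"
    by measurable
  moreover have "(\<lambda>t. (indicat_real (ivl a b) t *\<^sub>R k t) *
      (LINT s|lborel. indicator {t<..} s *\<^sub>R (indicator (ivl a b) s *\<^sub>R (f s * cnj (g s)))))
      = (\<lambda>t. indicat_real (ivl a b) t *\<^sub>R (k t * L2inner (ereal t) b f g))"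
    by (auto simp: fun_eq_iff indicator_def[of "ivl a b"] L2inner_cut_eq)
  ultimately show "set_borel_measurable lborel (ivl a b) (\<lambda>t. k t * L2inner (ereal t) b f g)"
    by (simp only: set_borel_measurable_def measurable_lborel2)
  have "(\<lambda>t. (indicat_real (ivl a b) t *\<^sub>R k t) *
      (LINT s|lborel. indicator {..<t} s *\<^sub>R (indicator (ivl a b) s *\<^sub>R (f s * cnj (g s))))) \<in> borel_measurable borel"
    by measurable
  moreover have "(\<lambda>t. (indicat_real (ivl a b) t *\<^sub>R k t) *
      (LINT s|lborel. indicator {..<t} s *\<^sub>R (indicator (ivl a b) s *\<^sub>R (f s * cnj (g s)))))
      = (\<lambda>t. indicat_real (ivl a b) t *\<^sub>R (k t * L2inner a (ereal t) f g))"
    by (auto simp: fun_eq_iff indicator_def[of "ivl a b"] L2inner_cut_eq(2))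
  ultimately show "set_borel_measurable lborel (ivl a b) (\<lambda>t. k t * L2inner a (ereal t) f g)"
    by (simp only: set_borel_measurable_def measurable_lborel2)
qed

lemma L2inner_cut_le:
  assumes f: "f \<in> L2 a b" and g: "g \<in> L2 a b" and t: "t \<in> ivl a b"
  shows "cmod (L2inner (ereal t) b f g) \<le> L2norm a b f * L2norm a b g"
    and "cmod (L2inner a (ereal t) f g) \<le> L2norm a b f * L2norm a b g"
proof -
  have t': "a \<le> ereal t" "ereal t \<le> b" using t by (auto simp: mem_ivl)
  show "cmod (L2inner (ereal t) b f g) \<le> L2norm a b f * L2norm a b g"
    by (rule order_trans[OF L2inner_le])
      (use assms t' in \<open>auto intro!: mult_mono L2norm_subinterval intro: L2_subinterval\<close>)
  show "cmod (L2inner a (ereal t) f g) \<le> L2norm a b f * L2norm a b g"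
    by (rule order_trans[OF L2inner_le])
      (use assms t' in \<open>auto intro!: mult_mono L2norm_subinterval intro: L2_subinterval\<close>)
qed

text \<open>Both sides integrate \<open>A t * B s\<close> over the triangle \<open>t < s\<close>;
  the product is integrable on the plane because each factor is integrable. This exchange produces
  the adjoint of the operator.\<close>

lemma triangle_Fubini:
  fixes A B :: "real \<Rightarrow> complex"
  assumes A: "integrable lborel A" and B: "integrable lborel B"
  shows "(LINT t|lborel. A t * (LINT s|lborel. indicator {t<..} s *\<^sub>R B s))
       = (LINT s|lborel. B s * (LINT t|lborel. indicator {..<s} t *\<^sub>R A t))"
proof -
  define F where "F = (\<lambda>(t, s). indicator {p. fst p < snd p} (t, s) *\<^sub>R (A t * B s))"
  have [measurable]: "A \<in> borel_measurable borel" "B \<in> borel_measurable borel"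
    using A B by (auto dest: borel_measurable_integrable)
  have AB: "integrable (lborel \<Otimes>\<^sub>M lborel) (\<lambda>(t, s). A t * B s)"
  proof (rule lborel_pair.Fubini_integrable)
    show "integrable lborel (\<lambda>x. LINT y|lborel. norm (case (x, y) of (t, s) \<Rightarrow> A t * B s))"
      using A B by (simp add: norm_mult)
    show "AE x in lborel. integrable lborel (\<lambda>y. case (x, y) of (t, s) \<Rightarrow> A t * B s)"
      using B by simp
  qed measurable
  have "integrable (lborel \<Otimes>\<^sub>M lborel) (\<lambda>x. indicator {p. fst p < snd p} x *\<^sub>R (case x of (t, s) \<Rightarrow> A t * B s))"
  proof (rule integrable_mult_indicator[OF _ AB])
    have "{p \<in> space (lborel \<Otimes>\<^sub>M lborel). fst p < snd p} \<in> sets (lborel \<Otimes>\<^sub>M lborel :: (real \<times> real) measure)"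
      by measurable
    then show "{p. fst p < snd p} \<in> sets (lborel \<Otimes>\<^sub>M lborel :: (real \<times> real) measure)"
      by (simp add: space_pair_measure)
  qed
  then have F: "integrable (lborel \<Otimes>\<^sub>M lborel) (\<lambda>(t, s). F (t, s))"
    by (rule back_subst[where P="integrable _"]) (auto simp: F_def fun_eq_iff)
  have "(LINT s|lborel. LINT t|lborel. F (t, s)) = (LINT t|lborel. LINT s|lborel. F (t, s))"
    using lborel_pair.Fubini_integral[OF F] by simp
  moreover have "(LINT s|lborel. F (t, s)) = A t * (LINT s|lborel. indicator {t<..} s *\<^sub>R B s)" for t
  proof -
    have "(LINT s|lborel. F (t, s)) = (LINT s|lborel. A t * (indicator {t<..} s *\<^sub>R B s))"
      by (intro Bochner_Integration.integral_cong) (auto simp: F_def indicator_def)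
    then show ?thesis by (simp only: integral_mult_right_zero)
  qed
  moreover have "(LINT t|lborel. F (t, s)) = B s * (LINT t|lborel. indicator {..<s} t *\<^sub>R A t)" for s
  proof -
    have "(LINT t|lborel. F (t, s)) = (LINT t|lborel. B s * (indicator {..<s} t *\<^sub>R A t))"
      by (intro Bochner_Integration.integral_cong) (auto simp: F_def indicator_def)
    then show ?thesis by (simp only: integral_mult_right_zero)
  qed
  ultimately show ?thesis by simp
qed

section \<open>Functions that vanish to the right of a point \<open>d\<close>\<close>

context
  fixes a b :: ereal and \<kappa> \<phi> :: "real \<Rightarrow> complex" and d :: real
  assumes kappa: "\<kappa> \<in> L2 a b"
    and phi_meas: "set_borel_measurable lborel (ivl a b) \<phi>"
    and phi_d: "\<phi> \<in> L2 a (ereal d)" and d_le: "ereal d \<le> b"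
begin

lemma phi_cut: "(\<lambda>x. indicator {..<d} x * \<phi> x) \<in> L2 a b"
proof -
  have "ivl a (ereal d) \<subseteq> ivl a b" using d_le by (intro ivl_mono) auto
  then show ?thesis
    using phi_d by (subst L2_indicator_iff[where c=a and d="ereal d"]) (auto simp: mem_ivl)
qed

text \<open>Left of \<open>d\<close> the image is a bounded function times the square integrable
  cut-off of \<phi>; right of \<open>d\<close> the inner integral sees only zeros of
  \<open>f\<close>. Such functions therefore lie in the domain.\<close>

lemma Tfun_cut_L2:
  assumes f: "f \<in> L2 a b" and f0: "\<And>x. x \<in> ivl a b \<Longrightarrow> d \<le> x \<Longrightarrow> f x = 0"
  shows "Tfun a b \<kappa> \<phi> f \<in> L2 a b"
proof (rule L2_bound[OF phi_cut, where C="L2norm a b f * L2norm a b \<kappa>"])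
  show "set_borel_measurable lborel (ivl a b) (Tfun a b \<kappa> \<phi> f)"
    using set_borel_measurable_mult_cut(1)[OF f kappa phi_meas] by (simp add: Tfun_eq[abs_def])
  have "cmod (Tfun a b \<kappa> \<phi> f x) \<le> L2norm a b f * L2norm a b \<kappa> * cmod (indicator {..<d} x * \<phi> x)"
    if x: "x \<in> ivl a b" for x
  proof (cases "x < d")
    case True
    then show ?thesis
      using L2inner_cut_le(1)[OF f kappa x] by (simp add: Tfun_eq norm_mult mult.commute[of _ "cmod (\<phi> x)"] mult_left_mono)
  next
    case False
    have "L2inner (ereal x) b f \<kappa> = L2inner (ereal x) b (\<lambda>_. 0) \<kappa>"
      using f0 False x by (intro L2inner_cong) (auto simp: mem_ivl_cut)
    then show ?thesis by (simp add: Tfun_eq L2inner_def)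
  qed
  then show "AE x in lborel. x \<in> ivl a b \<longrightarrow>
      cmod (Tfun a b \<kappa> \<phi> f x) \<le> L2norm a b f * L2norm a b \<kappa> * cmod (indicator {..<d} x * \<phi> x)"
    by simp
qed

text \<open>The formula comes from exchanging the integrals. As \<open>g\<close> vanishes beyond
  \<open>d\<close>, \<phi> may be replaced by its square integrable cut-off \<open>\<psi>\<close>,
  which makes the exchange legitimate for every \<open>f\<close> in \<open>L2 a b\<close>.\<close>

lemma adjoint_cut:
  assumes g: "g \<in> L2 a b" and g0: "\<And>x. x \<in> ivl a b \<Longrightarrow> d \<le> x \<Longrightarrow> g x = 0"
  shows "(g, \<lambda>s. \<kappa> s * L2inner a (ereal s) g \<phi>) \<in> adj_graph a b (T_graph a b \<kappa> \<phi>)"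
proof -
  define \<psi> where "\<psi> = (\<lambda>x. indicator {..<d} x * \<phi> x)"
  have psi: "\<psi> \<in> L2 a b" using phi_cut by (simp add: \<psi>_def)
  have prod_eq: "g x * cnj (\<phi> x) = g x * cnj (\<psi> x)" if "x \<in> ivl a b" for x
    using g0[OF that] by (cases "x < d") (auto simp: \<psi>_def)
  have in_eq: "L2inner a (ereal s) g \<phi> = L2inner a (ereal s) g \<psi>" if "s \<in> ivl a b" for s
    using prod_eq that by (intro L2inner_cong) (auto simp: mem_ivl_cut)
  have "(\<lambda>s. \<kappa> s * L2inner a (ereal s) g \<psi>) \<in> L2 a b"
  proof (rule L2_bound[OF kappa, where C="L2norm a b g * L2norm a b \<psi>"])
    show "set_borel_measurable lborel (ivl a b) (\<lambda>s. \<kappa> s * L2inner a (ereal s) g \<psi>)"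
      using set_borel_measurable_mult_cut(2)[OF g psi L2_measurable[OF kappa]] .
    show "AE x in lborel. x \<in> ivl a b \<longrightarrow>
        cmod (\<kappa> x * L2inner a (ereal x) g \<psi>) \<le> L2norm a b g * L2norm a b \<psi> * cmod (\<kappa> x)"
      using L2inner_cut_le(2)[OF g psi] by (auto simp: norm_mult mult.commute[of _ "cmod (\<kappa> _)"] mult_left_mono)
  qed
  then have hL2: "(\<lambda>s. \<kappa> s * L2inner a (ereal s) g \<phi>) \<in> L2 a b"
    by (subst L2_cong[where g="\<lambda>s. \<kappa> s * L2inner a (ereal s) g \<psi>"]) (auto simp: in_eq)
  have "L2inner a b (Tfun a b \<kappa> \<phi> f) g = L2inner a b f (\<lambda>s. \<kappa> s * L2inner a (ereal s) g \<phi>)"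
    if f: "f \<in> L2 a b" for f
  proof -
    define A where "A = (\<lambda>t. indicator (ivl a b) t *\<^sub>R (g t * cnj (\<psi> t)))"
    define B where "B = (\<lambda>s. indicator (ivl a b) s *\<^sub>R (f s * cnj (\<kappa> s)))"
    have A: "integrable lborel A" and B: "integrable lborel B"
      using L2_mult_cnj_integrable[OF g psi] L2_mult_cnj_integrable[OF f kappa]
      by (auto simp: A_def B_def set_integrable_def)
    \<comment> \<open>On the interval \<open>\<phi> t * cnj (g t)\<close> is the conjugate of
      \<open>A t\<close>, because \<psi> agrees with \<phi> wherever \<open>g\<close> does not
      vanish.\<close>
    have "L2inner a b (Tfun a b \<kappa> \<phi> f) g
        = (LINT t|lborel. cnj (A t) * (LINT s|lborel. indicator {t<..} s *\<^sub>R B s))"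
      unfolding L2inner_def set_lebesgue_integral_def
    proof (intro Bochner_Integration.integral_cong refl)
      fix t
      show "indicat_real (ivl a b) t *\<^sub>R (Tfun a b \<kappa> \<phi> f t * cnj (g t))
          = cnj (A t) * (LINT s|lborel. indicator {t<..} s *\<^sub>R B s)"
      proof (cases "t \<in> ivl a b")
        case True
        from arg_cong[OF prod_eq[OF True], of cnj] show ?thesis
          using True by (auto simp: Tfun_eq L2inner_cut_eq A_def B_def ac_simps)
      qed (simp add: A_def)
    qed
    also have "\<dots> = (LINT s|lborel. B s * (LINT t|lborel. indicator {..<s} t *\<^sub>R cnj (A t)))"
      using A B by (intro triangle_Fubini) auto
    also have "\<dots> = L2inner a b f (\<lambda>s. \<kappa> s * L2inner a (ereal s) g \<phi>)"
      unfolding L2inner_def[of a b f] set_lebesgue_integral_def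
    proof (intro Bochner_Integration.integral_cong refl)
      fix s
      show "B s * (LINT t|lborel. indicator {..<s} t *\<^sub>R cnj (A t))
        = indicat_real (ivl a b) s *\<^sub>R (f s * cnj (\<kappa> s * L2inner a (ereal s) g \<phi>))"
      proof (cases "s \<in> ivl a b")
        case True
        have "(LINT t|lborel. indicator {..<s} t *\<^sub>R cnj (A t)) = cnj (L2inner a (ereal s) g \<phi>)"
          unfolding in_eq[OF True] L2inner_cut_eq(2)[OF True, of g \<psi>]
          by (subst Bochner_Integration.integral_cnj[symmetric]) (simp add: A_def)
        then show ?thesis using True by (simp add: B_def)
      qed (simp add: B_def)
    qed
    finally show ?thesis .
  qed
  with g hL2 show ?thesis by (auto simp: adj_graph_def T_graph_def)
qed

end

section \<open>Compactness of the real part\<close>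

definition L2_Cauchy :: "ereal \<Rightarrow> ereal \<Rightarrow> (nat \<Rightarrow> real \<Rightarrow> complex) \<Rightarrow> bool" where
  "L2_Cauchy a b u \<longleftrightarrow> (\<forall>e>0. \<exists>N. \<forall>m\<ge>N. \<forall>n\<ge>N. L2norm a b (\<lambda>x. u m x - u n x) < e)"

lemma L2_CauchyD:
  assumes "L2_Cauchy a b u" "e > 0"
  obtains N where "\<And>m n. m \<ge> N \<Longrightarrow> n \<ge> N \<Longrightarrow> L2norm a b (\<lambda>x. u m x - u n x) < e"
  using assms unfolding L2_Cauchy_def by blast

lemma compact_op_iff:
  "compact_op a b G \<longleftrightarrow> G \<subseteq> L2 a b \<times> L2 a b \<and>
     (\<forall>f u B. (\<forall>n. (f n, u n) \<in> G \<and> L2norm a b (f n) \<le> B) \<longrightarrow>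
        (\<exists>r::nat \<Rightarrow> nat. strict_mono r \<and> L2_Cauchy a b (\<lambda>n. u (r n))))"
  unfolding compact_op_def L2_Cauchy_def ..

lemma compact_op_subseq:
  assumes "compact_op a b G" "\<And>n. (f n, u n) \<in> G" "\<And>n. L2norm a b (f n) \<le> B"
  obtains r :: "nat \<Rightarrow> nat" where "strict_mono r" "L2_Cauchy a b (\<lambda>n. u (r n))"
  using assms unfolding compact_op_iff by blast

text \<open>Otherwise the unit ball has images of norm above \<open>k\<close> for every
  \<open>k\<close>, but a Cauchy subsequence of them would be bounded.\<close>

lemma compact_op_bounded:
  assumes cpt: "compact_op a b G"
  obtains C where "0 \<le> C" "\<And>f u. (f, u) \<in> G \<Longrightarrow> L2norm a b f \<le> 1 \<Longrightarrow> L2norm a b u \<le> C"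
proof -
  have "\<exists>k::nat. \<forall>f u. (f, u) \<in> G \<longrightarrow> L2norm a b f \<le> 1 \<longrightarrow> L2norm a b u \<le> k"
  proof (rule ccontr)
    assume "\<not> ?thesis"
    then have "\<forall>k::nat. \<exists>f u. (f, u) \<in> G \<and> L2norm a b f \<le> 1 \<and> L2norm a b u > k"
      by (auto simp: not_le)
    then obtain f u where fu: "\<And>k::nat. (f k, u k) \<in> G" "\<And>k. L2norm a b (f k) \<le> 1" "\<And>k. L2norm a b (u k) > real k"
      by metis
    obtain r where r: "strict_mono r" "L2_Cauchy a b (\<lambda>n. u (r n))"
      by (rule compact_op_subseq[OF cpt fu(1,2)])
    obtain N where N: "\<And>m n. m \<ge> N \<Longrightarrow> n \<ge> N \<Longrightarrow> L2norm a b (\<lambda>x. u (r m) x - u (r n) x) < 1"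
      by (rule L2_CauchyD[OF r(2) zero_less_one]) blast
    have uL: "u k \<in> L2 a b" for k
      using cpt fu(1) by (auto simp: compact_op_def)
    obtain m :: nat where m: "real m > 1 + L2norm a b (u (r N))" "m \<ge> N"
      by (metis max.cobounded1 max.cobounded2 of_nat_le_iff order_less_le_trans reals_Archimedean2)
    have "real m \<le> real (r m)" using seq_suble[OF r(1)] by simp
    also have "\<dots> < L2norm a b (u (r m))" by (rule fu)
    also have "\<dots> \<le> L2norm a b (\<lambda>x. u (r m) x - u (r N) x) + L2norm a b (u (r N))"
      using L2norm_triangle[OF L2_diff[OF uL uL] uL, of "r m" "r N" "r N"] by simp
    also have "\<dots> < 1 + L2norm a b (u (r N))" using N m by auto
    finally show False using m by simp
  qed
  then show thesis using that by (metis of_nat_0_le_iff)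
qed

text \<open>The points \<open>X i\<close> are real and increase to \<open>b\<close>, which also
  covers infinite \<open>b\<close>; the tails of \<open>h\<close> beyond them shrink in
  norm.\<close>

lemma L2_truncation_approx:
  assumes h: "h \<in> L2 a b" and ab: "a < b" and e: "e > 0"
  obtains d where "a < ereal d" "ereal d < b"
    "L2norm a b (\<lambda>x. h x - indicator {..<d} x * h x) < e"
proof -
  obtain X where X: "incseq X" "\<And>i. a < ereal (X i)" "\<And>i. ereal (X i) < b" "(\<lambda>i. ereal (X i)) \<longlonglongrightarrow> b"
    using ereal_incseq_approx[OF ab] by metis
  have "(\<lambda>n. L2norm a b (\<lambda>x. indicator {X n..} x * h x)) \<longlonglongrightarrow> 0"
  proof (rule L2norm_indicator_tendsto_0[OF h])
    fix x assume "x \<in> ivl a b"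
    then have "ereal x < b" by (simp add: mem_ivl)
    from order_tendstoD(1)[OF X(4) this] show "\<forall>\<^sub>F n in sequentially. x \<notin> {X n..}"
      by eventually_elim auto
  qed auto
  from order_tendstoD(2)[OF this e] obtain n where "L2norm a b (\<lambda>x. indicator {X n..} x * h x) < e"
    by (auto simp: eventually_sequentially)
  moreover have "(\<lambda>x. indicator {X n..} x * h x) = (\<lambda>x. h x - indicator {..<X n} x * h x)"
    by (auto simp: indicator_def fun_eq_iff)
  ultimately show thesis using that[of "X n"] X by simp
qed

lemma adj_graph_diff:
  assumes "(f, h) \<in> adj_graph a b G" "(f', h') \<in> adj_graph a b G" "G \<subseteq> L2 a b \<times> L2 a b"
  shows "(\<lambda>x. f x - f' x, \<lambda>x. h x - h' x) \<in> adj_graph a b G"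
proof -
  have L: "f \<in> L2 a b" "h \<in> L2 a b" "f' \<in> L2 a b" "h' \<in> L2 a b"
    using assms by (auto simp: adj_graph_def)
  have "L2inner a b u (\<lambda>x. f x - f' x) = L2inner a b v (\<lambda>x. h x - h' x)" if "(v, u) \<in> G" for u v
  proof -
    have "u \<in> L2 a b" "v \<in> L2 a b" using that assms(3) by auto
    moreover have "L2inner a b u f = L2inner a b v h" "L2inner a b u f' = L2inner a b v h'"
      using assms(1,2) that by (auto simp: adj_graph_def)
    ultimately show ?thesis using L by (simp add: L2inner_diff_right)
  qed
  then show ?thesis using L by (auto simp: adj_graph_def intro!: L2_diff)
qed

text \<open>The functions \<open>h n\<close> may lie outside the domain of \<open>T\<close>, but
  their truncations \<open>g n\<close> lie inside. Testing the adjoint relation with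
  \<open>g n\<close> bounds these, so their images under \<open>T\<close> have a Cauchy subsequence;
  testing it with differences of the \<open>g n\<close> then controls the differences of the
  \<open>h n\<close>.\<close>

lemma adjoint_compact:
  fixes f h :: "nat \<Rightarrow> real \<Rightarrow> complex"
  assumes ab: "a < b" and kappa: "\<kappa> \<in> L2 a b"
    and phi_meas: "set_borel_measurable lborel (ivl a b) \<phi>"
    and phi_loc: "\<And>d. a < ereal d \<Longrightarrow> ereal d < b \<Longrightarrow> \<phi> \<in> L2 a (ereal d)"
    and cpt: "compact_op a b (T_graph a b \<kappa> \<phi>)"
    and adj: "\<And>n. (f n, h n) \<in> adj_graph a b (T_graph a b \<kappa> \<phi>)"
    and B: "\<And>n. L2norm a b (f n) \<le> B"
  obtains r :: "nat \<Rightarrow> nat" where "strict_mono r" "L2_Cauchy a b (\<lambda>n. h (r n))"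
proof -
  let ?G = "T_graph a b \<kappa> \<phi>"
  let ?T = "Tfun a b \<kappa> \<phi>"
  have GL: "?G \<subseteq> L2 a b \<times> L2 a b" by (auto simp: T_graph_def)
  have fL: "f n \<in> L2 a b" and hL: "h n \<in> L2 a b" for n
    using adj[of n] by (auto simp: adj_graph_def)
  have B0: "0 \<le> B" using B[of 0] L2norm_nonneg order_trans by blast
  obtain C where C: "0 \<le> C" "\<And>f u. (f, u) \<in> ?G \<Longrightarrow> L2norm a b f \<le> 1 \<Longrightarrow> L2norm a b u \<le> C"
    using compact_op_bounded[OF cpt] by blast
  \<comment> \<open>Boundedness on the unit ball extends by scaling, for which the norm of
    \<open>g\<close> has to be nonzero.\<close>
  have CT: "L2norm a b (?T g) \<le> C * L2norm a b g"
    if g: "(g, ?T g) \<in> ?G" "L2norm a b g \<noteq> 0" for g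
  proof -
    define k where "k = complex_of_real (1 / L2norm a b g)"
    have k: "cmod k = 1 / L2norm a b g" unfolding k_def by (simp only: norm_of_real) simp
    have "(\<lambda>x. k * g x, \<lambda>x. k * ?T g x) \<in> ?G"
      using g by (auto simp: mem_T_graph Tfun_mult intro: L2_mult_left)
    then have "L2norm a b (\<lambda>x. k * ?T g x) \<le> C"
      using g by (intro C(2)) (auto simp: L2norm_mult_left k)
    then show ?thesis
      using g L2norm_nonneg[of a b g] by (simp add: L2norm_mult_left k field_simps)
  qed
  have "\<exists>d. a < ereal d \<and> ereal d < b \<and> L2norm a b (\<lambda>x. h n x - indicator {..<d} x * h n x) < 1 / Suc n" for n
    using L2_truncation_approx[OF hL ab, of "1 / Suc n"] by (metis of_nat_0_less_iff zero_less_Suc zero_less_divide_1_iff)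
  then obtain d where d: "\<And>n. a < ereal (d n)" "\<And>n. ereal (d n) < b"
    "\<And>n. L2norm a b (\<lambda>x. h n x - indicator {..<d n} x * h n x) < 1 / Suc n"
    by metis
  define g where "g n = (\<lambda>x. indicator {..<d n} x * h n x)" for n
  have gL: "g n \<in> L2 a b" for n unfolding g_def by (intro L2_indicator hL) simp
  have gG: "(g n, ?T (g n)) \<in> ?G" for n
    using Tfun_cut_L2[OF kappa phi_meas phi_loc[OF d(1,2)] less_imp_le[OF d(2)] gL, of n n] gL
    by (auto simp: mem_T_graph g_def)
  \<comment> \<open>Where \<open>g n\<close> is nonzero it equals \<open>h n\<close>.\<close>
  have gh: "L2inner a b (g n) (h n) = L2inner a b (g n) (g n)" for n
    by (rule L2inner_cong) (auto simp: g_def indicator_def)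
  have gB: "L2norm a b (g n) \<le> C * B" for n
  proof (cases "L2norm a b (g n) = 0")
    case False
    \<comment> \<open>The adjoint relation turns the squared norm of \<open>g n\<close> into the
      inner product of \<open>?T (g n)\<close> with \<open>f n\<close>; one factor of the norm then
      cancels.\<close>
    have "complex_of_real ((L2norm a b (g n))\<^sup>2) = L2inner a b (?T (g n)) (f n)"
      using adj[of n] gG[of n] gh[of n] L2inner_self[OF gL[of n]] by (auto simp: adj_graph_def)
    then have "(L2norm a b (g n))\<^sup>2 = cmod (L2inner a b (?T (g n)) (f n))"
      by (metis norm_of_real abs_of_nonneg zero_le_power2)
    also have "\<dots> \<le> L2norm a b (?T (g n)) * L2norm a b (f n)"
      using gG[of n] by (intro L2inner_le fL) (auto simp: mem_T_graph)
    also have "\<dots> \<le> (C * L2norm a b (g n)) * B"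
      using CT[OF gG False] B B0 C(1) by (intro mult_mono) auto
    finally have "L2norm a b (g n) * L2norm a b (g n) \<le> L2norm a b (g n) * (C * B)"
      by (simp add: power2_eq_square ac_simps)
    then show ?thesis using False by (simp add: less_le)
  qed (use C B0 in auto)
  have dh: "L2norm a b (\<lambda>x. h n x - g n x) < 1 / Suc n" for n using d(3) by (simp add: g_def)
  have hB: "L2norm a b (h n) \<le> C * B + 1" for n
  proof -
    have "L2norm a b (h n) \<le> L2norm a b (\<lambda>x. h n x - g n x) + L2norm a b (g n)"
      using L2norm_triangle[OF L2_diff[OF hL gL] gL, of n n n] by simp
    also have "1 / real (Suc n) \<le> 1" by simp
    ultimately show ?thesis using dh[of n] gB[of n] by linarith
  qed
  obtain r where r: "strict_mono r" "L2_Cauchy a b (\<lambda>n. ?T (g (r n)))"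
    by (rule compact_op_subseq[OF cpt gG gB])
  \<comment> \<open>Bounds the norm of a difference of two functions \<open>h m\<close> and
    \<open>h n\<close>, each of norm at most \<open>C * B + 1\<close>.\<close>
  define D where "D = 2 * (C * B + 1)"
  have D0: "D > 0" using C B0 by (simp add: D_def add_nonneg_pos)
  have key: "(L2norm a b (\<lambda>x. h m x - h n x))\<^sup>2
      \<le> L2norm a b (\<lambda>x. ?T (g m) x - ?T (g n) x) * (2 * B) + (1 / Suc m + 1 / Suc n) * D" for m n
  proof -
    \<comment> \<open>Here \<open>w = v + y\<close> with \<open>v\<close> in the domain of
      \<open>T\<close> and \<open>y\<close> a truncation error. In the inner product of
      \<open>w\<close> with itself the part with \<open>v\<close> becomes one of \<open>?T v\<close>
      with \<open>f m - f n\<close>, and the part with \<open>y\<close> is small.\<close>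
    define w where "w = (\<lambda>x. h m x - h n x)"
    define v where "v = (\<lambda>x. g m x - g n x)"
    define y where "y = (\<lambda>x. (h m x - g m x) - (h n x - g n x))"
    have wL: "w \<in> L2 a b" and vL: "v \<in> L2 a b" and yL: "y \<in> L2 a b"
      unfolding w_def v_def y_def by (intro L2_diff hL gL)+
    have wD: "L2norm a b w \<le> D"
      using L2norm_triangle_diff[OF hL hL, of m n] hB[of m] hB[of n] by (simp add: w_def D_def)
    have yD: "L2norm a b y \<le> 1 / Suc m + 1 / Suc n"
      using L2norm_triangle_diff[OF L2_diff[OF hL gL] L2_diff[OF hL gL], of m m n n] dh[of m] dh[of n]
      by (simp add: y_def)
    have vT: "(v, ?T v) \<in> ?G"
    proof -
      have "?T v \<in> L2 a b \<longleftrightarrow> (\<lambda>x. ?T (g m) x - ?T (g n) x) \<in> L2 a b"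
        unfolding v_def by (intro L2_cong Tfun_diff gL kappa)
      then show ?thesis using vL gG[of m] gG[of n] by (auto simp: mem_T_graph intro: L2_diff)
    qed
    have Tv: "L2norm a b (?T v) = L2norm a b (\<lambda>x. ?T (g m) x - ?T (g n) x)"
      unfolding v_def by (intro L2norm_cong Tfun_diff gL kappa)
    have "L2inner a b v w = L2inner a b (?T v) (\<lambda>x. f m x - f n x)"
      using adj_graph_diff[OF adj adj GL, of m n] vT by (auto simp: adj_graph_def w_def)
    moreover have "L2inner a b w w = L2inner a b v w + L2inner a b y w"
      using L2inner_diff_left[OF wL vL wL] by (simp add: w_def v_def y_def algebra_simps)
    ultimately have "complex_of_real ((L2norm a b w)\<^sup>2) = L2inner a b (?T v) (\<lambda>x. f m x - f n x) + L2inner a b y w"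
      using L2inner_self[OF wL] by simp
    then have "(L2norm a b w)\<^sup>2 \<le> cmod (L2inner a b (?T v) (\<lambda>x. f m x - f n x)) + cmod (L2inner a b y w)"
      by (metis norm_of_real abs_of_nonneg zero_le_power2 norm_triangle_ineq)
    also have "cmod (L2inner a b (?T v) (\<lambda>x. f m x - f n x)) \<le> L2norm a b (?T v) * L2norm a b (\<lambda>x. f m x - f n x)"
      using vT by (intro L2inner_le L2_diff fL) (auto simp: mem_T_graph)
    also have "\<dots> \<le> L2norm a b (?T v) * (2 * B)"
      using L2norm_triangle_diff[OF fL fL, of m n] B[of m] B[of n] by (intro mult_left_mono) auto
    also have "cmod (L2inner a b y w) \<le> L2norm a b y * L2norm a b w" by (rule L2inner_le[OF yL wL])
    also have "\<dots> \<le> (1 / Suc m + 1 / Suc n) * D"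
      using yD wD by (intro mult_mono) auto
    finally show ?thesis by (simp add: w_def Tv)
  qed
  have "L2_Cauchy a b (\<lambda>n. h (r n))"
    unfolding L2_Cauchy_def
  proof (intro allI impI)
    fix e :: real assume e: "e > 0"
    \<comment> \<open>The bounds \<eta> and \<open>N2\<close> make the first term of
      \<open>key\<close> less than \<open>e\<^sup>2 / 2\<close> and the second at most that;
      \<open>B + 1\<close> avoids division by zero.\<close>
    define \<eta> where "\<eta> = e\<^sup>2 / (4 * (B + 1))"
    have eta: "\<eta> > 0" using e B0 by (simp add: \<eta>_def)
    obtain N1 where N1: "\<And>m n. m \<ge> N1 \<Longrightarrow> n \<ge> N1 \<Longrightarrow> L2norm a b (\<lambda>x. ?T (g (r m)) x - ?T (g (r n)) x) < \<eta>"
      by (rule L2_CauchyD[OF r(2) eta]) blast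
    obtain N2 :: nat where N2: "real N2 > 4 * D / e\<^sup>2" using reals_Archimedean2 by blast
    have small: "1 / real (Suc (r m)) \<le> e\<^sup>2 / (4 * D)" if "m \<ge> N2" for m
    proof -
      have "4 * D / e\<^sup>2 \<le> real (Suc (r m))"
        using N2 that seq_suble[OF r(1), of m] by linarith
      then show ?thesis using e D0 by (simp add: field_simps)
    qed
    show "\<exists>N. \<forall>m\<ge>N. \<forall>n\<ge>N. L2norm a b (\<lambda>x. h (r m) x - h (r n) x) < e"
    proof (intro exI allI impI)
      fix m n assume mn: "m \<ge> max N1 N2" "n \<ge> max N1 N2"
      have "(L2norm a b (\<lambda>x. h (r m) x - h (r n) x))\<^sup>2
        \<le> L2norm a b (\<lambda>x. ?T (g (r m)) x - ?T (g (r n)) x) * (2 * B) + (1 / Suc (r m) + 1 / Suc (r n)) * D"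
        by (rule key)
      also have "\<dots> \<le> \<eta> * (2 * B) + (e\<^sup>2 / (4 * D) + e\<^sup>2 / (4 * D)) * D"
        using N1[of m n] small[of m] small[of n] mn B0 D0 by (intro add_mono mult_right_mono) auto
      also have "\<dots> < e\<^sup>2"
      proof -
        have "\<eta> * (2 * B) < e\<^sup>2 / 2"
          using e B0 by (simp add: \<eta>_def field_simps)
        moreover have "(e\<^sup>2 / (4 * D) + e\<^sup>2 / (4 * D)) * D = e\<^sup>2 / 2"
          using D0 by (simp add: field_simps)
        ultimately show ?thesis by simp
      qed
      finally show "L2norm a b (\<lambda>x. h (r m) x - h (r n) x) < e"
        using e by (simp add: power_less_imp_less_base)
    qed
  qed
  with r(1) show thesis by (rule that)
qed

text \<open>Compactness of \<open>T\<close> gives a subsequence along which the images under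
  \<open>T\<close> are Cauchy, and \<open>adjoint_compact\<close> refines it for the adjoint part;
  half the sum is then Cauchy.\<close>

lemma Re_compact_of_compact:
  assumes ab: "a < b" and kappa: "\<kappa> \<in> L2 a b"
    and phi_meas: "set_borel_measurable lborel (ivl a b) \<phi>"
    and phi_loc: "\<And>d. a < ereal d \<Longrightarrow> ereal d < b \<Longrightarrow> \<phi> \<in> L2 a (ereal d)"
    and cpt: "compact_op a b (T_graph a b \<kappa> \<phi>)"
  shows "compact_op a b (Re_graph a b (T_graph a b \<kappa> \<phi>))"
proof -
  let ?G = "T_graph a b \<kappa> \<phi>"
  have sub: "Re_graph a b ?G \<subseteq> L2 a b \<times> L2 a b"
  proof -
    have "(\<lambda>x. (u x + h x) / 2) \<in> L2 a b" if "u \<in> L2 a b" "h \<in> L2 a b" for u h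
      using L2_mult_left[OF L2_add[OF that], of "1/2"] by simp
    then show ?thesis by (auto simp: Re_graph_def mem_T_graph adj_graph_def)
  qed
  have "\<exists>r::nat \<Rightarrow> nat. strict_mono r \<and> L2_Cauchy a b (\<lambda>n. w (r n))"
    if w: "\<forall>n. (f n, w n) \<in> Re_graph a b ?G \<and> L2norm a b (f n) \<le> B" for f w :: "nat \<Rightarrow> real \<Rightarrow> complex" and B
  proof -
    define u where "u n = Tfun a b \<kappa> \<phi> (f n)" for n
    have "\<forall>n. \<exists>h. (f n, u n) \<in> ?G \<and> (f n, h) \<in> adj_graph a b ?G \<and> w n = (\<lambda>x. (u n x + h x) / 2)"
      using w unfolding Re_graph_def by (auto simp: mem_T_graph u_def)
    from choice[OF this] obtain h where uh: "\<And>n. (f n, u n) \<in> ?G" "\<And>n. (f n, h n) \<in> adj_graph a b ?G"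
      "\<And>n. w n = (\<lambda>x. (u n x + h n x) / 2)" by blast
    have B: "L2norm a b (f n) \<le> B" for n using w by blast
    have uL: "u n \<in> L2 a b" and hL: "h n \<in> L2 a b" for n
      using uh(1,2)[of n] by (auto simp: mem_T_graph adj_graph_def)
    obtain r1 where r1: "strict_mono r1" "L2_Cauchy a b (\<lambda>n. u (r1 n))"
      by (rule compact_op_subseq[OF cpt uh(1) B])
    obtain r2 where r2: "strict_mono r2" "L2_Cauchy a b (\<lambda>n. h (r1 (r2 n)))"
      by (rule adjoint_compact[OF ab kappa phi_meas phi_loc cpt, of "\<lambda>n. f (r1 n)" "\<lambda>n. h (r1 n)" B])
        (auto intro: uh(2) B)
    show ?thesis
      unfolding L2_Cauchy_def
    proof (intro exI[of _ "\<lambda>n. r1 (r2 n)"] conjI allI impI)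
      show "strict_mono (\<lambda>n. r1 (r2 n))" using r1(1) r2(1) by (simp add: strict_mono_def)
      fix e :: real assume e: "e > 0"
      obtain N1 where N1: "\<And>m n. m \<ge> N1 \<Longrightarrow> n \<ge> N1 \<Longrightarrow> L2norm a b (\<lambda>x. u (r1 m) x - u (r1 n) x) < e"
        by (rule L2_CauchyD[OF r1(2) e]) blast
      obtain N2 where N2: "\<And>m n. m \<ge> N2 \<Longrightarrow> n \<ge> N2 \<Longrightarrow> L2norm a b (\<lambda>x. h (r1 (r2 m)) x - h (r1 (r2 n)) x) < e"
        by (rule L2_CauchyD[OF r2(2) e]) blast
      show "\<exists>N. \<forall>m\<ge>N. \<forall>n\<ge>N. L2norm a b (\<lambda>x. w (r1 (r2 m)) x - w (r1 (r2 n)) x) < e"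
      proof (intro exI allI impI)
        fix m n assume mn: "m \<ge> max N1 N2" "n \<ge> max N1 N2"
        let ?m = "r1 (r2 m)" and ?n = "r1 (r2 n)"
        \<comment> \<open>A subsequence never lowers an index, so \<open>N1\<close> still applies
          after composing with \<open>r2\<close>.\<close>
        have "r2 m \<ge> N1" "r2 n \<ge> N1"
          using mn seq_suble[OF r2(1), of m] seq_suble[OF r2(1), of n] by linarith+
        then have lt: "L2norm a b (\<lambda>x. u ?m x - u ?n x) < e" "L2norm a b (\<lambda>x. h ?m x - h ?n x) < e"
          using N1 N2 mn by auto
        have "(\<lambda>x. w ?m x - w ?n x) = (\<lambda>x. 1/2 * ((u ?m x - u ?n x) + (h ?m x - h ?n x)))"
          by (auto simp: uh(3) fun_eq_iff field_simps)
        then have "L2norm a b (\<lambda>x. w ?m x - w ?n x) = 1/2 * L2norm a b (\<lambda>x. (u ?m x - u ?n x) + (h ?m x - h ?n x))"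
          by (simp only: L2norm_mult_left) simp
        also have "\<dots> \<le> 1/2 * (L2norm a b (\<lambda>x. u ?m x - u ?n x) + L2norm a b (\<lambda>x. h ?m x - h ?n x))"
          by (intro mult_left_mono L2norm_triangle L2_diff uL hL) auto
        also have "\<dots> < e" using lt by simp
        finally show "L2norm a b (\<lambda>x. w ?m x - w ?n x) < e" .
      qed
    qed
  qed
  with sub show ?thesis unfolding compact_op_iff by blast
qed

section \<open>Off-diagonal blocks of the real part\<close>

text \<open>The conditions on \<phi> and on the tails of \<kappa> are phrased through subintervals
  in place of cut-offs on \<open>(a,b)\<close>.\<close>

locale dyadic_partition =
  fixes a b :: ereal and \<kappa> \<phi> :: "real \<Rightarrow> complex" and c :: "nat \<Rightarrow> ereal"
  assumes kappa: "\<kappa> \<in> L2 a b"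
    and phi_meas: "set_borel_measurable lborel (ivl a b) \<phi>"
    and phi_loc: "\<And>d. a < ereal d \<Longrightarrow> ereal d < b \<Longrightarrow> \<phi> \<in> L2 a (ereal d)"
    and c0: "c 0 = a" and c_mono: "strict_mono c" and c_lt: "\<And>n. c n < b"
    and c_norm: "\<And>n. (L2norm (c n) b \<kappa>)\<^sup>2 = (1/2) ^ n * (L2norm a b \<kappa>)\<^sup>2"
begin

definition E :: "nat \<Rightarrow> real set" where "E n = ivl (c n) (c (Suc n))"
definition kn :: "nat \<Rightarrow> real" where "kn n = L2norm (c n) (c (Suc n)) \<kappa>"
definition pn :: "nat \<Rightarrow> real" where "pn n = L2norm (c n) (c (Suc n)) \<phi>"

lemma c_ge: "a \<le> c n"
  using strict_mono_less_eq[OF c_mono, of 0 n] by (simp add: c0)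

lemma c_less: "c n < c (Suc n)"
  using c_mono by (simp add: strict_mono_def)

text \<open>Only \<open>c 0\<close> can be infinite, since the later points lie strictly between
  \<open>a\<close> and \<open>b\<close>.\<close>

lemma c_real: obtains d where "c (Suc n) = ereal d"
proof -
  have "c (Suc n) \<noteq> -\<infinity>" "c (Suc n) \<noteq> \<infinity>"
    using c_less[of n] c_lt[of "Suc n"] by auto
  then show thesis using that by (cases "c (Suc n)") auto
qed

text \<open>Passing through the real point \<open>c (Suc n)\<close> also covers \<open>c 0\<close>,
  which may be infinite.\<close>

lemma phi_c: "\<phi> \<in> L2 a (c n)"
proof -
  obtain d where d: "c (Suc n) = ereal d" by (rule c_real)
  have "\<phi> \<in> L2 a (ereal d)"
    using phi_loc[of d] c_lt[of "Suc n"] le_less_trans[OF c_ge c_less, of n] by (simp add: d)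
  then show ?thesis
    by (rule L2_subinterval) (use c_less[of n] in \<open>auto simp: d\<close>)
qed

lemma E_sets [measurable, simp]: "E n \<in> sets borel" by (simp add: E_def)

lemma E_sub: "E n \<subseteq> ivl a b"
  unfolding E_def using c_ge c_lt by (intro ivl_mono) (auto intro: less_imp_le)

lemma E_less:
  assumes "x \<in> E m" "y \<in> E n" "x < y"
  shows "m \<le> n"
proof (rule ccontr)
  assume "\<not> m \<le> n"
  then have "c (Suc n) \<le> c m" by (subst strict_mono_less_eq[OF c_mono]) simp
  moreover have "ereal y < c (Suc n)" "c m < ereal x" using assms(1,2) by (auto simp: E_def mem_ivl)
  ultimately have "ereal y < ereal x" by (metis order.strict_trans2 order.strict_trans)
  with assms(3) show False by simp
qed

lemma E_unique: "x \<in> E m \<Longrightarrow> x \<in> E n \<Longrightarrow> m = n"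
proof (rule ccontr)
  have *: False if "x \<in> E m" "x \<in> E n" "m < n" for m n
  proof -
    have "c (Suc m) \<le> c n" using that by (subst strict_mono_less_eq[OF c_mono]) simp
    with that show False by (auto simp: E_def mem_ivl)
  qed
  assume "x \<in> E m" "x \<in> E n" "m \<noteq> n"
  then show False using *[of m n] *[of n m] by linarith
qed

text \<open>The tails from \<open>c n\<close> and from \<open>c (Suc n)\<close> differ by the block
  \<open>E n\<close>, and \<open>(1/2) ^ n - (1/2) ^ Suc n = (1/2) ^ Suc n\<close>.\<close>

lemma kn_sq: "(kn n)\<^sup>2 = (1/2) ^ Suc n * (L2norm a b \<kappa>)\<^sup>2"
proof -
  obtain d where d: "c (Suc n) = ereal d" by (rule c_real)
  have "(L2norm (c n) b \<kappa>)\<^sup>2 = (kn n)\<^sup>2 + (L2norm (c (Suc n)) b \<kappa>)\<^sup>2"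
    unfolding kn_def d
    by (rule L2norm_split[OF L2_subinterval[OF kappa]])
      (use c_ge c_less[of n] c_lt[of "Suc n"] in \<open>auto simp: d\<close>)
  then show ?thesis by (simp add: c_norm)
qed

text \<open>The exact factor is \<open>sqrt 2\<close>; the bound 2 avoids the root.\<close>

lemma kn_Suc: "kn n \<le> 2 * kn (Suc n)"
proof (rule power2_le_imp_le)
  show "(kn n)\<^sup>2 \<le> (2 * kn (Suc n))\<^sup>2" by (simp add: power_mult_distrib kn_sq)
qed (simp add: kn_def)

lemma L2norm_E: "L2norm a b (\<lambda>x. indicator (E n) x * f x) = L2norm (c n) (c (Suc n)) f"
  using E_sub[of n] by (intro L2norm_indicator) (auto simp: E_def)

text \<open>The function \<open>f n\<close> lives on \<open>E n\<close>, while on \<open>E (Suc n)\<close> only the adjoint part of the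
  real part of \<open>T\<close> sees it, where it acts as a rank one operator.\<close>

lemma test_functions:
  obtains f w where "\<And>n. (f n, w n) \<in> Re_graph a b (T_graph a b \<kappa> \<phi>)"
    "\<And>n. L2norm a b (f n) \<le> 1"
    "\<And>n. kn n * pn n / 4 \<le> L2norm (c (Suc n)) (c (Suc (Suc n))) (w n)"
proof -
  \<comment> \<open>If \<open>pn n = 0\<close>, division by zero makes \<open>f n\<close> the zero
    function, and the claimed bounds still hold.\<close>
  define f where "f n = (\<lambda>x. complex_of_real (1 / pn n) * (indicator (E n) x * \<phi> x))" for n
  define h where "h n = (\<lambda>s. \<kappa> s * L2inner a (ereal s) (f n) \<phi>)" for n
  define w where "w n = (\<lambda>x. (Tfun a b \<kappa> \<phi> (f n) x + h n x) / 2)" for n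
  have phiE: "(\<lambda>x. indicator (E n) x * \<phi> x) \<in> L2 a b" for n
  proof -
    have "\<phi> \<in> L2 (c n) (c (Suc n))" by (rule L2_subinterval[OF phi_c[of "Suc n"] c_ge]) simp
    then show ?thesis
      using E_sub[of n] by (subst L2_indicator_iff[where c="c n" and d="c (Suc n)"]) (auto simp: E_def)
  qed
  have fL: "f n \<in> L2 a b" for n unfolding f_def by (intro L2_mult_left phiE)
  have f0: "f n x = 0" if "x \<notin> E n" for n x using that by (simp add: f_def)
  have graph: "(f n, w n) \<in> Re_graph a b (T_graph a b \<kappa> \<phi>)" for n
  proof -
    obtain d where d: "c (Suc n) = ereal d" by (rule c_real)
    have phid: "\<phi> \<in> L2 a (ereal d)" using phi_c[of "Suc n"] by (simp add: d)
    have db: "ereal d \<le> b" using c_lt[of "Suc n"] by (simp add: d)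
    have fz: "f n x = 0" if "x \<in> ivl a b" "d \<le> x" for x
      using that d by (intro f0) (auto simp: E_def mem_ivl)
    have "(f n, Tfun a b \<kappa> \<phi> (f n)) \<in> T_graph a b \<kappa> \<phi>"
      using Tfun_cut_L2[OF kappa phi_meas phid db fL fz] fL by (simp add: mem_T_graph)
    moreover have "(f n, h n) \<in> adj_graph a b (T_graph a b \<kappa> \<phi>)"
      unfolding h_def using adjoint_cut[OF kappa phi_meas phid db fL fz] by simp
    ultimately show ?thesis unfolding Re_graph_def w_def by blast
  qed
  have fn: "L2norm a b (f n) \<le> 1" for n
  proof -
    have "L2norm a b (f n) = cmod (complex_of_real (1 / pn n)) * pn n"
      unfolding f_def L2norm_mult_left L2norm_E pn_def ..
    also have "\<dots> \<le> 1" unfolding norm_of_real by (simp add: pn_def)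
    finally show ?thesis .
  qed
  have wE: "w n x = complex_of_real (pn n / 2) * \<kappa> x" if x: "x \<in> E (Suc n)" for n x
  proof -
    have lt: "y < x" if "y \<in> E n" for y
      using that x unfolding E_def mem_ivl by (metis ereal_less(1) order.strict_trans less_ereal.simps(1))
    have xi: "x \<in> ivl a b" using x E_sub by blast
    \<comment> \<open>To the right of \<open>x\<close> the function \<open>f n\<close> vanishes, so
      \<open>T\<close> itself contributes nothing at \<open>x\<close>.\<close>
    have "L2inner (ereal x) b (f n) \<kappa> = L2inner (ereal x) b (\<lambda>_. 0) \<kappa>"
      using lt xi by (intro L2inner_cong) (auto simp: mem_ivl_cut intro!: f0 dest: lt)
    then have "Tfun a b \<kappa> \<phi> (f n) x = 0" by (simp add: Tfun_eq L2inner_def)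
    moreover have "L2inner a (ereal x) (f n) \<phi> = complex_of_real (pn n)"
    proof -
      \<comment> \<open>All of \<open>E n\<close> lies to the left of \<open>x\<close>, so the inner
        product runs over the whole block and is independent of \<open>x\<close>; this is the rank
        one structure.\<close>
      have "indicat_real (ivl a (ereal x)) s *\<^sub>R (f n s * cnj (\<phi> s))
          = indicat_real (E n) s *\<^sub>R (complex_of_real (1 / pn n) * (\<phi> s * cnj (\<phi> s)))" for s
      proof (cases "s \<in> E n")
        case True
        then have "s \<in> ivl a (ereal x)" using lt E_sub[of n] by (auto simp: mem_ivl_cut[OF xi])
        then show ?thesis using True by (simp add: f_def)
      qed (simp add: f0)
      then have "L2inner a (ereal x) (f n) \<phi>
          = L2inner (c n) (c (Suc n)) (\<lambda>s. complex_of_real (1 / pn n) * \<phi> s) \<phi>"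
        unfolding L2inner_def set_lebesgue_integral_def E_def by (simp only: mult.assoc)
      also have "\<dots> = complex_of_real (1 / pn n) * complex_of_real ((pn n)\<^sup>2)"
        unfolding L2inner_mult_left pn_def
        by (subst L2inner_self[OF L2_subinterval[OF phi_c[of "Suc n"] c_ge]]) auto
      also have "\<dots> = complex_of_real (pn n)"
        by (simp add: power2_eq_square)
      finally show ?thesis .
    qed
    ultimately show ?thesis by (simp add: w_def h_def)
  qed
  have "kn n * pn n / 4 \<le> L2norm (c (Suc n)) (c (Suc (Suc n))) (w n)" for n
  proof -
    have "L2norm (c (Suc n)) (c (Suc (Suc n))) (w n)
        = L2norm (c (Suc n)) (c (Suc (Suc n))) (\<lambda>x. complex_of_real (pn n / 2) * \<kappa> x)"
      by (intro L2norm_cong wE) (simp add: E_def)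
    also have "\<dots> = pn n / 2 * kn (Suc n)"
      unfolding L2norm_mult_left kn_def norm_of_real by (simp add: pn_def)
    \<comment> \<open>One factor 1/2 comes from the real part, the other from
      \<open>kn_Suc\<close>.\<close>
    also have "\<dots> \<ge> pn n / 2 * (kn n / 2)"
      using kn_Suc[of n] by (intro mult_left_mono) (auto simp: pn_def)
    finally show ?thesis by (simp add: mult.commute)
  qed
  with graph fn show thesis by (rule that)
qed

text \<open>If \<open>kn n * pn n\<close> stays above \<open>e\<close> along a subsequence, the
  images of the test functions keep norm at least \<open>e / 4\<close> on blocks that move off. A
  Cauchy subsequence stays within \<open>e / 8\<close> of one fixed image, whose norm on these
  blocks tends to zero.\<close>

lemma omega_tendsto_0:
  assumes cpt: "compact_op a b (Re_graph a b (T_graph a b \<kappa> \<phi>))"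
  shows "(\<lambda>n. kn n * pn n) \<longlonglongrightarrow> 0"
proof (rule ccontr)
  assume "\<not> ?thesis"
  then obtain e where e: "e > 0" "\<not> eventually (\<lambda>n. dist (kn n * pn n) 0 < e) sequentially"
    unfolding tendsto_iff by blast
  from not_eventually_sequentiallyD[OF e(2)] obtain s :: "nat \<Rightarrow> nat"
    where s: "strict_mono s" "\<And>n. \<not> dist (kn (s n) * pn (s n)) 0 < e" by blast
  have ge: "e \<le> kn (s n) * pn (s n)" for n
    using s(2)[of n] by (simp add: dist_norm kn_def pn_def)
  obtain f w where fw: "\<And>n. (f n, w n) \<in> Re_graph a b (T_graph a b \<kappa> \<phi>)"
    "\<And>n. L2norm a b (f n) \<le> 1"
    "\<And>n. kn n * pn n / 4 \<le> L2norm (c (Suc n)) (c (Suc (Suc n))) (w n)"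
    by (rule test_functions) blast
  have wL: "w n \<in> L2 a b" for n
    using fw(1)[of n] cpt by (auto simp: compact_op_def)
  obtain r where r: "strict_mono r" "L2_Cauchy a b (\<lambda>n. w (s (r n)))"
    by (rule compact_op_subseq[OF cpt, of "\<lambda>n. f (s n)" "\<lambda>n. w (s n)" 1]) (auto intro: fw)
  have "e / 8 > 0" using e by simp
  obtain N where N: "\<And>m n. m \<ge> N \<Longrightarrow> n \<ge> N \<Longrightarrow> L2norm a b (\<lambda>x. w (s (r m)) x - w (s (r n)) x) < e / 8"
    by (rule L2_CauchyD[OF r(2) \<open>e / 8 > 0\<close>]) blast
  \<comment> \<open>The block on which \<open>w (s (r m))\<close> is known to be large, one after
    the block that carries \<open>f (s (r m))\<close>.\<close>
  define j where "j m = Suc (s (r m))" for m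
  have j: "strict_mono j" using s(1) r(1) by (auto simp: strict_mono_def j_def)
  have "(\<lambda>m. L2norm a b (\<lambda>x. indicator (E (j m)) x * w (s (r N)) x)) \<longlonglongrightarrow> 0"
  proof (rule L2norm_indicator_tendsto_0[OF wL])
    fix x
    show "\<forall>\<^sub>F m in sequentially. x \<notin> E (j m)"
    proof (cases "\<exists>i. x \<in> E i")
      case True
      then obtain i where i: "x \<in> E i" by blast
      show ?thesis
        \<comment> \<open>Once \<open>m > i\<close>, the index \<open>j m \<ge> m\<close> differs
          from that of the only block containing \<open>x\<close>.\<close>
        using eventually_gt_at_top[of i]
      proof eventually_elim
        case (elim m)
        with seq_suble[OF j, of m] show ?case using E_unique[OF i] by force
      qed
    qed auto
  qed simp
  from order_tendstoD(2)[OF this \<open>e / 8 > 0\<close>] obtain M where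
    M: "\<And>m. m \<ge> M \<Longrightarrow> L2norm a b (\<lambda>x. indicator (E (j m)) x * w (s (r N)) x) < e / 8"
    by (auto simp: eventually_sequentially)
  define m where "m = max M N"
  have "e / 4 \<le> L2norm (c (j m)) (c (Suc (j m))) (w (s (r m)))"
    using fw(3)[of "s (r m)"] ge[of "r m"] by (simp add: j_def)
  also have "\<dots> \<le> L2norm (c (j m)) (c (Suc (j m))) (\<lambda>x. w (s (r m)) x - w (s (r N)) x)
      + L2norm (c (j m)) (c (Suc (j m))) (w (s (r N)))"
    using L2norm_triangle[of "\<lambda>x. w (s (r m)) x - w (s (r N)) x" "c (j m)" "c (Suc (j m))" "w (s (r N))"]
      L2_subinterval[OF L2_diff[OF wL wL] c_ge less_imp_le[OF c_lt]]
      L2_subinterval[OF wL c_ge less_imp_le[OF c_lt]] by simp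
  also have "L2norm (c (j m)) (c (Suc (j m))) (\<lambda>x. w (s (r m)) x - w (s (r N)) x)
      \<le> L2norm a b (\<lambda>x. w (s (r m)) x - w (s (r N)) x)"
    by (rule L2norm_subinterval[OF L2_diff[OF wL wL] c_ge less_imp_le[OF c_lt]])
  also have "\<dots> < e / 8" by (rule N) (auto simp: m_def)
  also have "L2norm (c (j m)) (c (Suc (j m))) (w (s (r N))) < e / 8"
    using M[of m] by (simp add: m_def L2norm_E)
  finally show False by simp
qed

end

section \<open>A weighted Hardy inequality\<close>

text \<open>Connects the norm with nonnegative integrals. Functions appear extended by zero from
  \<open>ivl a b\<close>, the form they take in \<open>hardy_tail\<close>.\<close>

lemma nn_integral_L2norm:
  assumes "f \<in> L2 c d" "ivl c d \<subseteq> ivl a b"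
  shows "(\<integral>\<^sup>+s. indicator (ivl c d) s * ennreal ((cmod (indicator (ivl a b) s *\<^sub>R f s))\<^sup>2) \<partial>lborel)
    = ennreal ((L2norm c d f)\<^sup>2)"
proof -
  have "(\<integral>\<^sup>+s. indicator (ivl c d) s * ennreal ((cmod (indicator (ivl a b) s *\<^sub>R f s))\<^sup>2) \<partial>lborel)
      = (\<integral>\<^sup>+s. ennreal (indicator (ivl c d) s *\<^sub>R (cmod (f s))\<^sup>2) \<partial>lborel)"
    using assms(2) by (intro nn_integral_cong) (auto simp: indicator_def)
  also have "\<dots> = ennreal ((L2norm c d f)\<^sup>2)"
    using L2_square_integrable[OF assms(1)] unfolding L2norm_square set_lebesgue_integral_def
    by (intro nn_integral_eq_integral) (auto simp: set_integrable_def)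
  finally show ?thesis .
qed

text \<open>A growing geometric sum is dominated by its last term, with the factor
  \<open>25/9 = 1 / (1 - 16/25)\<close>.\<close>

lemma sum_power_le: "(\<Sum>n=N..m. (25/16::real) ^ n) \<le> 25/9 * (25/16) ^ m"
proof -
  have "(\<Sum>n=N..m. (25/16::real) ^ n) \<le> (\<Sum>n\<le>m. (25/16) ^ n)"
    by (intro sum_mono2) auto
  also have "\<dots> \<le> 25/9 * (25/16) ^ m"
    by (induction m) auto
  finally show ?thesis .
qed

context dyadic_partition
begin

text \<open>The blocks miss the points \<open>c n\<close> and everything beyond all of them. The
  \<open>c n\<close> need not tend to \<open>b\<close>, but \<kappa> vanishes almost everywhere on
  what is missed; see \<open>kappa_AE\<close>.\<close>

definition D :: "real set" where "D = (\<Union>n. E n)"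
text \<open>Unspecified outside \<open>D\<close>; in \<open>hardy_tail\<close> it is always guarded
  by membership in a block.\<close>

definition idx :: "real \<Rightarrow> nat" where "idx s = (LEAST n. s \<in> E n)"

lemma D_sets [measurable, simp]: "D \<in> sets borel" by (auto simp: D_def)

lemma idx_measurable [measurable]: "idx \<in> measurable borel (count_space UNIV)"
  unfolding idx_def[abs_def] by measurable

lemma idx_E: "s \<in> E n \<Longrightarrow> idx s = n"
  unfolding idx_def by (rule Least_equality) (use E_unique in blast)+

lemma nn_integral_E:
  assumes "f \<in> L2 (c n) (c (Suc n))" and that: "0 \<le> k"
  shows "(\<integral>\<^sup>+s. indicator (E n) s * ennreal (k * (cmod (indicator (ivl a b) s *\<^sub>R f s))\<^sup>2) \<partial>lborel)
    = ennreal (k * (L2norm (c n) (c (Suc n)) f)\<^sup>2)"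
proof -
  have m: "(\<lambda>s. indicator (E n) s * ennreal ((cmod (indicator (ivl a b) s *\<^sub>R f s))\<^sup>2)) \<in> borel_measurable lborel"
  proof -
    have [measurable]: "(\<lambda>s. indicator (E n) s *\<^sub>R (cmod (f s))\<^sup>2) \<in> borel_measurable borel"
      using L2_square_integrable[OF assms(1)] by (auto simp: set_integrable_def E_def dest: borel_measurable_integrable)
    have "(\<lambda>s. ennreal (indicator (E n) s *\<^sub>R (cmod (f s))\<^sup>2)) \<in> borel_measurable borel"
      by measurable
    moreover have "(\<lambda>s. indicator (E n) s * ennreal ((cmod (indicator (ivl a b) s *\<^sub>R f s))\<^sup>2))
        = (\<lambda>s. ennreal (indicator (E n) s *\<^sub>R (cmod (f s))\<^sup>2))"
      using E_sub[of n] by (auto simp: indicator_def fun_eq_iff)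
    ultimately show ?thesis by (simp only: measurable_lborel2)
  qed
  have "(\<integral>\<^sup>+s. indicator (E n) s * ennreal (k * (cmod (indicator (ivl a b) s *\<^sub>R f s))\<^sup>2) \<partial>lborel)
      = (\<integral>\<^sup>+s. ennreal k * (indicator (E n) s * ennreal ((cmod (indicator (ivl a b) s *\<^sub>R f s))\<^sup>2)) \<partial>lborel)"
    using that by (intro nn_integral_cong) (auto simp: ennreal_mult indicator_def)
  also have "\<dots> = ennreal k * (\<integral>\<^sup>+s. indicator (E n) s * ennreal ((cmod (indicator (ivl a b) s *\<^sub>R f s))\<^sup>2) \<partial>lborel)"
    by (rule nn_integral_cmult[OF m])
  also have "\<dots> = ennreal (k * (L2norm (c n) (c (Suc n)) f)\<^sup>2)"
    using that unfolding E_def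
    by (subst nn_integral_L2norm[OF assms(1)]) (use E_sub[of n] in \<open>auto simp: E_def ennreal_mult\<close>)
  finally show ?thesis .
qed

text \<open>A weighted Cauchy--Schwarz inequality with the weight \<open>(25/16) ^ n\<close> on \<open>E n\<close>. Any ratio strictly
  between 1 and 2 works: the weight must grow geometrically, but slower than the square of the norm of
  \<open>\<kappa>\<close> on \<open>E n\<close> decays.\<close>

lemma hardy_tail:
  assumes f: "f \<in> L2 a b" and small: "\<And>n. n \<ge> N \<Longrightarrow> (kn n * pn n)\<^sup>2 \<le> \<delta>"
  defines "f' \<equiv> (\<lambda>s. indicator (ivl a b) s *\<^sub>R f s)"
    and "\<kappa>' \<equiv> (\<lambda>s. indicator (ivl a b) s *\<^sub>R \<kappa> s)"
    and "\<phi>' \<equiv> (\<lambda>s. indicator (ivl a b) s *\<^sub>R \<phi> s)"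
  defines "H \<equiv> (\<lambda>t. \<integral>\<^sup>+s. (if t < s \<and> s \<in> D then ennreal (cmod (f' s) * cmod (\<kappa>' s)) else 0) \<partial>lborel)"
  shows "(\<integral>\<^sup>+t. indicator (\<Union>n\<in>{N..}. E n) t * (ennreal ((cmod (\<phi>' t))\<^sup>2) * (H t)\<^sup>2) \<partial>lborel)
    \<le> ennreal (13 * \<delta> * (L2norm a b f)\<^sup>2)"
proof -
  have [measurable]: "f' \<in> borel_measurable borel" "\<kappa>' \<in> borel_measurable borel" "\<phi>' \<in> borel_measurable borel"
    using L2_measurable[OF f] L2_measurable[OF kappa] phi_meas
    by (auto simp: f'_def \<kappa>'_def \<phi>'_def set_borel_measurable_def)
  have delta: "0 \<le> \<delta>" using small[of N] order_trans[OF zero_le_power2] by blast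
  define K where "K = (L2norm a b \<kappa>)\<^sup>2"
  define A where "A t = (\<integral>\<^sup>+s. (if t < s \<and> s \<in> D then ennreal ((25/16) ^ idx s * (cmod (\<kappa>' s))\<^sup>2) else 0) \<partial>lborel)" for t
  define B where "B t = (\<integral>\<^sup>+s. (if t < s \<and> s \<in> D then ennreal ((16/25) ^ idx s * (cmod (f' s))\<^sup>2) else 0) \<partial>lborel)" for t
  \<comment> \<open>A bound for \<open>A\<close> on \<open>E n\<close>: the series of
    \<open>(25/16) ^ m * (kn m)\<^sup>2\<close> over \<open>m \<ge> n\<close> is geometric with
    ratio \<open>25/32\<close> and first term \<open>K / 2 * (25/32) ^ n\<close>, and
    \<open>1 / (1 - 25/32) = 32/7\<close>.\<close>
  define \<alpha> where "\<alpha> n = 16/7 * K * (25/32) ^ n" for n :: nat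
  have HAB: "(H t)\<^sup>2 \<le> A t * B t" for t
  proof -
    \<comment> \<open>Since \<open>25/16\<close> is the square of \<open>5/4\<close>,
      Cauchy--Schwarz produces the weights of \<open>A\<close> and \<open>B\<close> from the
      rational factors \<open>5/4\<close> and \<open>4/5\<close>, which cancel in the
      product.\<close>
    define g1 where "g1 s = (if t < s \<and> s \<in> D then ennreal ((5/4) ^ idx s * cmod (\<kappa>' s)) else 0)" for s
    define g2 where "g2 s = (if t < s \<and> s \<in> D then ennreal ((4/5) ^ idx s * cmod (f' s)) else 0)" for s
    have [measurable]: "g1 \<in> borel_measurable lborel" "g2 \<in> borel_measurable lborel"
      unfolding g1_def[abs_def] g2_def[abs_def] by measurable
    have "H t = (\<integral>\<^sup>+s. g1 s * g2 s \<partial>lborel)"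
      unfolding H_def
    proof (intro nn_integral_cong)
      fix s
      have "(5/4) ^ idx s * cmod (\<kappa>' s) * ((4/5) ^ idx s * cmod (f' s))
          = ((5/4) ^ idx s * (4/5) ^ idx s) * (cmod (f' s) * cmod (\<kappa>' s))" by simp
      also have "(5/4::real) ^ idx s * (4/5) ^ idx s = 1"
        by (simp flip: power_mult_distrib)
      finally show "(if t < s \<and> s \<in> D then ennreal (cmod (f' s) * cmod (\<kappa>' s)) else 0) = g1 s * g2 s"
        by (auto simp: g1_def g2_def simp flip: ennreal_mult)
    qed
    moreover have "A t = (\<integral>\<^sup>+s. g1 s ^ 2 \<partial>lborel)"
      unfolding A_def g1_def
      by (intro nn_integral_cong) (simp add: ennreal_power power_mult_distrib power2_eq_square flip: power_mult_distrib ennreal_mult)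
    moreover have "B t = (\<integral>\<^sup>+s. g2 s ^ 2 \<partial>lborel)"
      unfolding B_def g2_def
      by (intro nn_integral_cong) (simp add: ennreal_power power_mult_distrib power2_eq_square flip: power_mult_distrib ennreal_mult)
    ultimately show ?thesis
      using Cauchy_Schwarz_nn_integral[of g1 lborel g2] by simp
  qed
  have kL: "\<kappa> \<in> L2 (c n) (c (Suc n))" for n
    by (rule L2_subinterval[OF kappa c_ge less_imp_le[OF c_lt]])
  have pL: "\<phi> \<in> L2 (c n) (c (Suc n))" for n
    by (rule L2_subinterval[OF phi_c[of "Suc n"] c_ge]) simp
  have A_le: "A t \<le> ennreal (\<alpha> n)" if t: "t \<in> E n" for t n
  proof -
    \<comment> \<open>Only blocks of index at least \<open>n\<close> can contain a point
      \<open>s > t\<close>.\<close>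
    have "A t \<le> (\<integral>\<^sup>+s. (\<Sum>i. indicator (E (n + i)) s * ennreal ((25/16) ^ (n + i) * (cmod (\<kappa>' s))\<^sup>2)) \<partial>lborel)"
      unfolding A_def
    proof (intro nn_integral_mono)
      fix s
      show "(if t < s \<and> s \<in> D then ennreal ((25/16) ^ idx s * (cmod (\<kappa>' s))\<^sup>2) else 0)
        \<le> (\<Sum>i. indicator (E (n + i)) s * ennreal ((25/16) ^ (n + i) * (cmod (\<kappa>' s))\<^sup>2))"
      proof (cases "t < s \<and> s \<in> D")
        case True
        then obtain m where m: "s \<in> E m" by (auto simp: D_def)
        then obtain i where i: "m = n + i" using E_less[OF t m] True le_Suc_ex by blast
        define F where "F j = indicator (E (n + j)) s * ennreal ((25/16) ^ (n + j) * (cmod (\<kappa>' s))\<^sup>2)" for j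
        have "sum F {i} \<le> suminf F" by (intro sum_le_suminf) auto
        moreover have "sum F {i} = ennreal ((25/16) ^ idx s * (cmod (\<kappa>' s))\<^sup>2)"
          using m idx_E[OF m] by (simp add: F_def i)
        ultimately show ?thesis using True unfolding F_def[symmetric] by simp
      qed auto
    qed
    also have "\<dots> = (\<Sum>i. \<integral>\<^sup>+s. indicator (E (n + i)) s * ennreal ((25/16) ^ (n + i) * (cmod (\<kappa>' s))\<^sup>2) \<partial>lborel)"
      by (intro nn_integral_suminf) measurable
    also have "\<dots> = (\<Sum>i. ennreal ((25/16) ^ (n + i) * (kn (n + i))\<^sup>2))"
      unfolding \<kappa>'_def kn_def by (subst nn_integral_E[OF kL]) auto
    also have "\<dots> = ennreal (\<alpha> n)"
    proof (rule suminf_ennreal_eq)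
      have "(\<lambda>i. K / 2 * (25/32) ^ n * (25/32) ^ i) sums (K / 2 * (25/32) ^ n * (1 / (1 - 25/32)))"
        by (intro sums_mult geometric_sums) auto
      moreover have "(25/16) ^ (n + i) * (kn (n + i))\<^sup>2 = K / 2 * (25/32) ^ n * (25/32) ^ i" for i
      proof -
        have "(25/16::real) ^ (n + i) * (1/2) ^ (n + i) = (25/32) ^ (n + i)"
          by (simp flip: power_mult_distrib)
        then show ?thesis by (simp add: kn_sq K_def power_add)
      qed
      moreover have "K / 2 * (25/32) ^ n * (1 / (1 - 25/32)) = \<alpha> n" by (simp add: \<alpha>_def)
      ultimately show "(\<lambda>i. (25/16) ^ (n + i) * (kn (n + i))\<^sup>2) sums \<alpha> n"
        by (simp only:)
    qed simp
    finally show ?thesis .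
  qed
  \<comment> \<open>As \<open>K * (1/2) ^ n = 2 * (kn n)\<^sup>2\<close>, the product contains the
    square of \<open>kn n * pn n\<close>, and the smallness hypothesis enters.\<close>
  have alpha_p: "\<alpha> n * (pn n)\<^sup>2 \<le> 32/7 * \<delta> * (25/16) ^ n" if "n \<ge> N" for n
  proof -
    have "(25/32::real) ^ n = (1/2) ^ n * (25/16) ^ n"
      by (simp flip: power_mult_distrib)
    then have "\<alpha> n * (pn n)\<^sup>2 = 32/7 * ((kn n * pn n)\<^sup>2 * (25/16) ^ n)"
      by (simp add: \<alpha>_def power_mult_distrib kn_sq K_def)
    also have "\<dots> \<le> 32/7 * (\<delta> * (25/16) ^ n)"
      using small[OF that] by (intro mult_left_mono mult_right_mono) auto
    finally show ?thesis by simp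
  qed
  \<comment> \<open>The factor from \<phi> times the bound \<open>\<alpha>\<close> for
    \<open>A t\<close>, restricted to the tail blocks.\<close>
  define G where "G t = indicator (\<Union>n\<in>{N..}. E n) t * ennreal (\<alpha> (idx t) * (cmod (\<phi>' t))\<^sup>2)" for t
  have alpha0: "0 \<le> \<alpha> n" for n by (simp add: \<alpha>_def K_def)
  have [measurable]: "G \<in> borel_measurable borel"
    unfolding G_def[abs_def] by measurable
  have G_le: "(\<integral>\<^sup>+t. (if t < s then G t else 0) \<partial>lborel) \<le> ennreal (13 * \<delta> * (25/16) ^ m)"
    if s: "s \<in> E m" for s m
  proof -
    have "(\<integral>\<^sup>+t. (if t < s then G t else 0) \<partial>lborel)
        \<le> (\<integral>\<^sup>+t. (\<Sum>n=N..m. indicator (E n) t * ennreal (\<alpha> n * (cmod (\<phi>' t))\<^sup>2)) \<partial>lborel)"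
    proof (intro nn_integral_mono)
      fix t
      show "(if t < s then G t else 0) \<le> (\<Sum>n=N..m. indicator (E n) t * ennreal (\<alpha> n * (cmod (\<phi>' t))\<^sup>2))"
      proof (cases "t < s \<and> t \<in> (\<Union>n\<in>{N..}. E n)")
        case True
        then obtain n where n: "n \<ge> N" "t \<in> E n" by auto
        then have "n \<le> m" using E_less[OF n(2) s] True by simp
        then have "(\<Sum>j\<in>{n}. indicator (E j) t * ennreal (\<alpha> j * (cmod (\<phi>' t))\<^sup>2))
          \<le> (\<Sum>j=N..m. indicator (E j) t * ennreal (\<alpha> j * (cmod (\<phi>' t))\<^sup>2))"
          using n by (intro sum_mono2) auto
        then show ?thesis using True n idx_E[OF n(2)] by (simp add: G_def)
      qed (auto simp: G_def)
    qed
    also have "\<dots> = (\<Sum>n=N..m. \<integral>\<^sup>+t. indicator (E n) t * ennreal (\<alpha> n * (cmod (\<phi>' t))\<^sup>2) \<partial>lborel)"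
      by (intro nn_integral_sum) measurable
    also have "\<dots> = (\<Sum>n=N..m. ennreal (\<alpha> n * (pn n)\<^sup>2))"
      unfolding \<phi>'_def pn_def by (subst nn_integral_E[OF pL alpha0]) auto
    also have "\<dots> = ennreal (\<Sum>n=N..m. \<alpha> n * (pn n)\<^sup>2)"
      using alpha0 by (intro sum_ennreal) simp
    also have "\<dots> \<le> ennreal (13 * \<delta> * (25/16) ^ m)"
    proof (rule ennreal_leI)
      have "(\<Sum>n=N..m. \<alpha> n * (pn n)\<^sup>2) \<le> (\<Sum>n=N..m. 32/7 * \<delta> * (25/16) ^ n)"
        using alpha_p by (intro sum_mono) simp
      also have "\<dots> = 32/7 * \<delta> * (\<Sum>n=N..m. (25/16) ^ n)" by (simp add: sum_distrib_left)
      also have "\<dots> \<le> 32/7 * \<delta> * (25/9 * (25/16) ^ m)"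
        using delta by (intro mult_left_mono sum_power_le) auto
      \<comment> \<open>The exact constant \<open>32/7 * 25/9 = 800/63\<close> lies just below
        13.\<close>
      also have "\<dots> \<le> 13 * \<delta> * (25/16) ^ m"
        using delta by (simp add: mult_right_mono)
      finally show "(\<Sum>n=N..m. \<alpha> n * (pn n)\<^sup>2) \<le> 13 * \<delta> * (25/16) ^ m" .
    qed
    finally show ?thesis .
  qed
  define W where "W s = (if s \<in> D then ennreal ((16/25) ^ idx s * (cmod (f' s))\<^sup>2) else 0)" for s
  have [measurable]: "W \<in> borel_measurable borel"
    unfolding W_def[abs_def] by measurable
  have "(\<integral>\<^sup>+t. indicator (\<Union>n\<in>{N..}. E n) t * (ennreal ((cmod (\<phi>' t))\<^sup>2) * (H t)\<^sup>2) \<partial>lborel)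
      \<le> (\<integral>\<^sup>+t. G t * B t \<partial>lborel)"
  proof (intro nn_integral_mono)
    fix t
    show "indicator (\<Union>n\<in>{N..}. E n) t * (ennreal ((cmod (\<phi>' t))\<^sup>2) * (H t)\<^sup>2) \<le> G t * B t"
    proof (cases "t \<in> (\<Union>n\<in>{N..}. E n)")
      case True
      then obtain n where n: "t \<in> E n" by auto
      have "(H t)\<^sup>2 \<le> ennreal (\<alpha> n) * B t"
        using HAB[of t] A_le[OF n] by (meson mult_right_mono order_trans zero_le)
      then have "ennreal ((cmod (\<phi>' t))\<^sup>2) * (H t)\<^sup>2 \<le> ennreal ((cmod (\<phi>' t))\<^sup>2) * (ennreal (\<alpha> n) * B t)"
        by (rule mult_left_mono) simp
      also have "\<dots> = ennreal (\<alpha> n * (cmod (\<phi>' t))\<^sup>2) * B t"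
        using alpha0 by (simp add: ennreal_mult ac_simps)
      finally show ?thesis using True idx_E[OF n] by (simp add: G_def)
    qed simp
  qed
  also have "\<dots> = (\<integral>\<^sup>+t. (\<integral>\<^sup>+s. (if t < s then G t * W s else 0) \<partial>lborel) \<partial>lborel)"
  proof (intro nn_integral_cong)
    fix t
    have "G t * B t = (\<integral>\<^sup>+s. G t * (if t < s \<and> s \<in> D then ennreal ((16/25) ^ idx s * (cmod (f' s))\<^sup>2) else 0) \<partial>lborel)"
      unfolding B_def by (intro nn_integral_cmult[symmetric]) measurable
    also have "\<dots> = (\<integral>\<^sup>+s. (if t < s then G t * W s else 0) \<partial>lborel)"
      by (intro nn_integral_cong) (auto simp: W_def)
    finally show "G t * B t = (\<integral>\<^sup>+s. (if t < s then G t * W s else 0) \<partial>lborel)" .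
  qed
  \<comment> \<open>Tonelli's theorem. For fixed \<open>s\<close> in \<open>E m\<close> the integral
    of \<open>G\<close> grows at most like \<open>(25/16) ^ m\<close>, which the weight
    \<open>(16/25) ^ m\<close> in \<open>W s\<close> cancels.\<close>
  also have "\<dots> = (\<integral>\<^sup>+s. (\<integral>\<^sup>+t. (if t < s then G t * W s else 0) \<partial>lborel) \<partial>lborel)"
    by (rule lborel_pair.Fubini') measurable
  also have "\<dots> \<le> (\<integral>\<^sup>+s. ennreal (13 * \<delta>) * ennreal ((cmod (f' s))\<^sup>2) \<partial>lborel)"
  proof (intro nn_integral_mono)
    fix s
    have "(\<integral>\<^sup>+t. (if t < s then G t * W s else 0) \<partial>lborel) = (\<integral>\<^sup>+t. (if t < s then G t else 0) * W s \<partial>lborel)"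
      by (intro nn_integral_cong) auto
    also have "\<dots> = (\<integral>\<^sup>+t. (if t < s then G t else 0) \<partial>lborel) * W s"
      by (rule nn_integral_multc) measurable
    also have "\<dots> \<le> ennreal (13 * \<delta>) * ennreal ((cmod (f' s))\<^sup>2)"
    proof (cases "s \<in> D")
      case True
      then obtain m where m: "s \<in> E m" by (auto simp: D_def)
      have "(\<integral>\<^sup>+t. (if t < s then G t else 0) \<partial>lborel) * W s \<le> ennreal (13 * \<delta> * (25/16) ^ m) * W s"
        by (rule mult_right_mono[OF G_le[OF m]]) simp
      also have "\<dots> = ennreal (13 * \<delta> * ((25/16) ^ m * (16/25) ^ m) * (cmod (f' s))\<^sup>2)"
        using True delta idx_E[OF m] by (simp add: W_def ac_simps flip: ennreal_mult)
      also have "(25/16::real) ^ m * (16/25) ^ m = 1"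
        by (simp flip: power_mult_distrib)
      finally show ?thesis using delta by (simp add: ennreal_mult)
    qed (simp add: W_def)
    finally show "(\<integral>\<^sup>+t. (if t < s then G t * W s else 0) \<partial>lborel) \<le> ennreal (13 * \<delta>) * ennreal ((cmod (f' s))\<^sup>2)" .
  qed
  also have "\<dots> = ennreal (13 * \<delta>) * (\<integral>\<^sup>+s. indicator (ivl a b) s * ennreal ((cmod (f' s))\<^sup>2) \<partial>lborel)"
  proof -
    have "(\<integral>\<^sup>+s. ennreal (13 * \<delta>) * ennreal ((cmod (f' s))\<^sup>2) \<partial>lborel)
        = ennreal (13 * \<delta>) * (\<integral>\<^sup>+s. ennreal ((cmod (f' s))\<^sup>2) \<partial>lborel)"
      by (rule nn_integral_cmult) measurable
    also have "(\<integral>\<^sup>+s. ennreal ((cmod (f' s))\<^sup>2) \<partial>lborel)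
        = (\<integral>\<^sup>+s. indicator (ivl a b) s * ennreal ((cmod (f' s))\<^sup>2) \<partial>lborel)"
      by (intro nn_integral_cong) (simp add: f'_def indicator_def)
    finally show ?thesis .
  qed
  also have "\<dots> = ennreal (13 * \<delta> * (L2norm a b f)\<^sup>2)"
    unfolding f'_def using delta by (subst nn_integral_L2norm[OF f]) (auto simp: ennreal_mult)
  finally show ?thesis .
qed

end

section \<open>Compactness of the operator\<close>

lemma L2norm_eq_0_AE:
  assumes "f \<in> L2 a b" "L2norm a b f = 0"
  shows "AE x in lborel. x \<in> ivl a b \<longrightarrow> f x = 0"
proof -
  have i: "integrable lborel (\<lambda>x. indicator (ivl a b) x *\<^sub>R (cmod (f x))\<^sup>2)"
    using L2_square_integrable[OF assms(1)] by (simp add: set_integrable_def)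
  have "(LINT x|lborel. indicator (ivl a b) x *\<^sub>R (cmod (f x))\<^sup>2) = 0"
    using assms(2) L2norm_square[of a b f] by (simp add: set_lebesgue_integral_def)
  then have "AE x in lborel. indicator (ivl a b) x *\<^sub>R (cmod (f x))\<^sup>2 = 0"
    by (subst integral_nonneg_eq_0_iff_AE[symmetric, OF i]) auto
  then show ?thesis by eventually_elim auto
qed

lemma L2inner_split:
  assumes "f \<in> L2 a b" "g \<in> L2 a b" "a \<le> ereal d" "ereal d \<le> b"
  shows "L2inner a b f g = L2inner a d f g + L2inner d b f g"
  unfolding L2inner_def
  by (rule set_integral_ivl_split[OF L2_mult_cnj_integrable[OF assms(1,2)] assms(3,4)])

text \<open>The intervals \<open>(t, t + 1 / (n + 1))\<close> leave every point, so the norm over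
  them tends to zero. Density of the rationals gives the endpoint, and \<open>z\<close> keeps it
  below \<open>b\<close>.\<close>

lemma L2norm_small_right:
  assumes h: "h \<in> L2 a b" and t: "t \<in> ivl a b" and e: "e > 0"
  obtains q where "q \<in> \<rat>" "t < q" "ereal q < b" "L2norm t q h < e"
proof -
  have hL: "h \<in> L2 (ereal t) b" using t by (intro L2_subinterval[OF h]) (auto simp: mem_ivl)
  have "(\<lambda>n. L2norm t b (\<lambda>x. indicator {t<..<t + 1 / real (Suc n)} x * h x)) \<longlonglongrightarrow> 0"
  proof (rule L2norm_indicator_tendsto_0[OF hL])
    fix x assume "x \<in> ivl (ereal t) b"
    then have "x - t > 0" by (simp add: mem_ivl)
    from order_tendstoD(2)[OF LIMSEQ_inverse_real_of_nat this]
    show "\<forall>\<^sub>F n in sequentially. x \<notin> {t<..<t + 1 / real (Suc n)}"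
      by eventually_elim (auto simp: inverse_eq_divide)
  qed simp
  from order_tendstoD(2)[OF this e] obtain n where
    n: "L2norm t b (\<lambda>x. indicator {t<..<t + 1 / real (Suc n)} x * h x) < e"
    by (auto simp: eventually_sequentially)
  obtain z where z: "ereal t < ereal z" "ereal z < b"
    using ereal_dense2[of "ereal t" b] t by (auto simp: mem_ivl)
  have "t < min z (t + 1 / real (Suc n))" using z by simp
  from Rats_dense_in_real[OF this] obtain q where
    q: "q \<in> \<rat>" "t < q" "q < min z (t + 1 / real (Suc n))" by blast
  have qb: "ereal q < b" using q(3) z(2) by (metis less_ereal.simps(1) min_less_iff_conj order.strict_trans)
  have "L2norm t q h = L2norm t q (\<lambda>x. indicator {t<..<t + 1 / real (Suc n)} x * h x)"
    using q by (intro L2norm_cong) (auto simp: mem_ivl)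
  also have "\<dots> \<le> L2norm t b (\<lambda>x. indicator {t<..<t + 1 / real (Suc n)} x * h x)"
    using qb by (intro L2norm_subinterval L2_indicator hL) auto
  also note n
  finally show thesis using that[of q] q qb by blast
qed

text \<open>Convergence at the rationals suffices, because the inner products are equicontinuous in \<open>t\<close>.\<close>

lemma L2inner_cut_convergent_subseq:
  assumes h: "h \<in> L2 a b" and f: "\<And>n. f n \<in> L2 a b" and B: "\<And>n. L2norm a b (f n) \<le> B"
  obtains r :: "nat \<Rightarrow> nat" where "strict_mono r"
    "\<And>t. t \<in> ivl a b \<Longrightarrow> convergent (\<lambda>n. L2inner (ereal t) b (f (r n)) h)"
proof -
  let ?F = "\<lambda>n t. L2inner (ereal t) b (f n) h"
  have B0: "0 \<le> B" using B[of 0] L2norm_nonneg order_trans by blast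
  \<comment> \<open>A uniform bound on a countable set gives a subsequence converging at all its
    points, by a diagonal argument.\<close>
  have "countable (\<rat> \<inter> ivl a b)" using countable_rat by blast
  moreover have "norm (?F n t) \<le> B * L2norm a b h" if "t \<in> \<rat> \<inter> ivl a b" for n t
    using order_trans[OF L2inner_cut_le(1)[OF f h, of t n] mult_right_mono[OF B[of n] L2norm_nonneg]] that by blast
  ultimately obtain r where r: "strict_mono r"
    "\<And>t. t \<in> \<rat> \<inter> ivl a b \<Longrightarrow> \<exists>l. (\<lambda>n. ?F (r n) t) \<longlonglongrightarrow> l"
    by (rule function_convergent_subsequence[of "\<rat> \<inter> ivl a b" ?F "B * L2norm a b h"]) blast+
  have "Cauchy (\<lambda>n. ?F (r n) t)" if t: "t \<in> ivl a b" for t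
  proof (rule metric_CauchyI)
    fix e :: real assume e: "e > 0"
    \<comment> \<open>This tolerance times \<open>B\<close> is at most \<open>e / 3\<close>, also
      for \<open>B = 0\<close>.\<close>
    have "e / (3 * (B + 1)) > 0" using e B0 by simp
    then obtain q where q: "q \<in> \<rat>" "t < q" "ereal q < b" "L2norm t q h < e / (3 * (B + 1))"
      by (rule L2norm_small_right[OF h t])
    have tq: "q \<in> \<rat> \<inter> ivl a b" using q t by (auto simp: mem_ivl intro: less_trans[of a "ereal t"])
    have close: "cmod (?F n t - ?F n q) \<le> e / 3" for n
    proof -
      have L: "f n \<in> L2 (ereal t) b" "h \<in> L2 (ereal t) b" "f n \<in> L2 (ereal t) (ereal q)" "h \<in> L2 (ereal t) (ereal q)"
        using t q by (auto simp: mem_ivl intro!: L2_subinterval[OF f] L2_subinterval[OF h])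
      \<comment> \<open>The difference is an integral over \<open>(t,q)\<close>, so the norm of
        \<open>h\<close> there bounds it uniformly in \<open>n\<close>.\<close>
      have "?F n t - ?F n q = L2inner t q (f n) h"
        using L2inner_split[OF L(1,2), of q] q by simp
      then have "cmod (?F n t - ?F n q) \<le> L2norm t q (f n) * L2norm t q h"
        using L2inner_le[OF L(3,4)] by simp
      also have "\<dots> \<le> B * (e / (3 * (B + 1)))"
      proof (intro mult_mono)
        show "L2norm t q (f n) \<le> B"
          using t order_trans[OF L2norm_subinterval[OF f _ less_imp_le[OF q(3)]] B[of n], of "ereal t"]
          by (simp add: mem_ivl less_imp_le)
      qed (simp_all only: B0 less_imp_le[OF q(4)] L2norm_nonneg)
      also have "\<dots> \<le> e / 3" using e B0 by (simp add: field_simps)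
      finally show ?thesis .
    qed
    have "Cauchy (\<lambda>n. ?F (r n) q)" using r(2)[OF tq] by (auto intro: LIMSEQ_imp_Cauchy)
    from metric_CauchyD[OF this, of "e/3"] e obtain M where
      M: "\<And>m n. m \<ge> M \<Longrightarrow> n \<ge> M \<Longrightarrow> cmod (?F (r m) q - ?F (r n) q) < e / 3"
      by (auto simp: dist_norm)
    show "\<exists>M. \<forall>m\<ge>M. \<forall>n\<ge>M. dist (?F (r m) t) (?F (r n) t) < e"
    proof (intro exI allI impI)
      fix m n assume mn: "m \<ge> M" "n \<ge> M"
      have "cmod (?F (r m) t - ?F (r n) t)
        = cmod ((?F (r m) t - ?F (r m) q) + (?F (r m) q - ?F (r n) q) - (?F (r n) t - ?F (r n) q))"
        by simp
      also have "\<dots> \<le> cmod (?F (r m) t - ?F (r m) q) + cmod (?F (r m) q - ?F (r n) q) + cmod (?F (r n) t - ?F (r n) q)"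
        using norm_triangle_ineq4[of "(?F (r m) t - ?F (r m) q) + (?F (r m) q - ?F (r n) q)" "?F (r n) t - ?F (r n) q"]
          norm_triangle_ineq[of "?F (r m) t - ?F (r m) q" "?F (r m) q - ?F (r n) q"] by linarith
      also have "\<dots> < e" using close[of "r m"] close[of "r n"] M[OF mn] by linarith
      finally show "dist (?F (r m) t) (?F (r n) t) < e" by (simp add: dist_norm)
    qed
  qed
  then have "convergent (\<lambda>n. ?F (r n) t)" if "t \<in> ivl a b" for t
    using that by (simp add: Cauchy_convergent)
  with r(1) show thesis by (rule that)
qed

section \<open>The tail of the operator, and compactness from decay of the block norms\<close>

context dyadic_partition
begin

lemma AE_not_c: "AE x in lborel. \<forall>n. ereal x \<noteq> c n"
proof -
  have "AE x in lborel. ereal x \<noteq> c n" for n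
  proof (cases "c n")
    case (real r)
    then show ?thesis using AE_lborel_singleton[of r] by simp
  qed auto
  then show ?thesis by (simp add: AE_all_countable)
qed

text \<open>By induction: a point to the right of \<open>c n\<close> but outside \<open>E n\<close>
  is to the right of \<open>c (Suc n)\<close>, as equality is excluded.\<close>

lemma not_in_D:
  assumes "x \<in> ivl a b" "x \<notin> D" "\<forall>n. ereal x \<noteq> c n"
  shows "c n < ereal x"
proof (induction n)
  case 0
  show ?case using assms(1) by (simp add: c0 mem_ivl)
next
  case (Suc n)
  have "x \<notin> E n" using assms(2) by (auto simp: D_def)
  with Suc have "c (Suc n) \<le> ereal x" by (simp add: E_def mem_ivl not_less)
  with assms(3) show ?case by (metis order.not_eq_order_implies_strict)
qed

text \<open>The norms of \<kappa> over \<open>(c n, b)\<close> tend to zero, so \<kappa> vanishes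
  almost everywhere beyond all \<open>c n\<close>; the points \<open>c n\<close> themselves form a
  null set.\<close>

lemma kappa_AE: "AE x in lborel. x \<in> ivl a b \<and> x \<notin> D \<longrightarrow> \<kappa> x = 0"
proof -
  define Z where "Z = {x. \<forall>n. c n < ereal x}"
  have Z: "Z \<in> sets borel" unfolding Z_def by measurable
  have ZL: "(\<lambda>x. indicator Z x * \<kappa> x) \<in> L2 a b" by (rule L2_indicator[OF kappa Z])
  have le: "(L2norm a b (\<lambda>x. indicator Z x * \<kappa> x))\<^sup>2 \<le> (1/2) ^ n * (L2norm a b \<kappa>)\<^sup>2" for n
  proof -
    have sub: "ivl (c n) b \<subseteq> ivl a b" using c_ge by (intro ivl_mono) auto
    have "L2norm a b (\<lambda>x. indicator Z x * \<kappa> x) \<le> L2norm a b (\<lambda>x. indicator (ivl (c n) b) x * \<kappa> x)"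
      by (intro L2norm_mono_AE ZL L2_indicator kappa sets_ivl) (auto simp: Z_def indicator_def mem_ivl)
    also have "\<dots> = L2norm (c n) b \<kappa>" using sub by (intro L2norm_indicator) auto
    finally show ?thesis by (subst c_norm[symmetric]) (intro power_mono; simp)
  qed
  have "(\<lambda>n. (1/2) ^ n * (L2norm a b \<kappa>)\<^sup>2) \<longlonglongrightarrow> 0 * (L2norm a b \<kappa>)\<^sup>2"
    by (intro tendsto_mult tendsto_const LIMSEQ_power_zero) simp
  from LIMSEQ_le_const[OF this, of "(L2norm a b (\<lambda>x. indicator Z x * \<kappa> x))\<^sup>2"] le
  have "(L2norm a b (\<lambda>x. indicator Z x * \<kappa> x))\<^sup>2 \<le> 0" by auto
  then have "L2norm a b (\<lambda>x. indicator Z x * \<kappa> x) = 0" by simp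
  from L2norm_eq_0_AE[OF ZL this] AE_not_c show ?thesis
  proof eventually_elim
    case (elim x)
    show ?case
    proof (intro impI)
      assume x: "x \<in> ivl a b \<and> x \<notin> D"
      then have "x \<in> Z" unfolding Z_def using not_in_D[of x] elim by auto
      with elim x show "\<kappa> x = 0" by auto
    qed
  qed
qed

text \<open>The inner integral is at most \<open>H t\<close> because \<kappa> vanishes almost
  everywhere off \<open>D\<close>; then \<open>hardy_tail\<close> applies.\<close>

lemma Tfun_tail:
  assumes f: "f \<in> L2 a b" and Tf: "Tfun a b \<kappa> \<phi> f \<in> L2 a b"
    and small: "\<And>n. n \<ge> N \<Longrightarrow> (kn n * pn n)\<^sup>2 \<le> \<delta>"
  shows "(L2norm (c N) b (Tfun a b \<kappa> \<phi> f))\<^sup>2 \<le> 13 * \<delta> * (L2norm a b f)\<^sup>2"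
proof -
  define f' where "f' = (\<lambda>s. indicator (ivl a b) s *\<^sub>R f s)"
  define \<kappa>' where "\<kappa>' = (\<lambda>s. indicator (ivl a b) s *\<^sub>R \<kappa> s)"
  define \<phi>' where "\<phi>' = (\<lambda>s. indicator (ivl a b) s *\<^sub>R \<phi> s)"
  define H where "H = (\<lambda>t. \<integral>\<^sup>+s. (if t < s \<and> s \<in> D then ennreal (cmod (f' s) * cmod (\<kappa>' s)) else 0) \<partial>lborel)"
  have delta: "0 \<le> \<delta>" using small[of N] order_trans[OF zero_le_power2] by blast
  have sub: "ivl (c N) b \<subseteq> ivl a b" using c_ge by (intro ivl_mono) auto
  have H: "ennreal (cmod (L2inner (ereal t) b f \<kappa>)) \<le> H t" if t: "t \<in> ivl a b" for t
  proof -
    have "f \<in> L2 (ereal t) b" "\<kappa> \<in> L2 (ereal t) b"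
      using t by (auto simp: mem_ivl intro!: L2_subinterval[OF f] L2_subinterval[OF kappa])
    from L2_mult_cnj_integrable[OF this]
    have i: "integrable lborel (\<lambda>s. indicator (ivl (ereal t) b) s *\<^sub>R (f s * cnj (\<kappa> s)))"
      by (simp add: set_integrable_def)
    have "ennreal (cmod (L2inner (ereal t) b f \<kappa>))
        \<le> (\<integral>\<^sup>+s. ennreal (cmod (indicator (ivl (ereal t) b) s *\<^sub>R (f s * cnj (\<kappa> s)))) \<partial>lborel)"
      unfolding L2inner_def set_lebesgue_integral_def using integral_norm_bound_ennreal[OF i] by simp
    also have "\<dots> \<le> H t"
      unfolding H_def
    proof (rule nn_integral_mono_AE)
      show "AE s in lborel. ennreal (cmod (indicator (ivl (ereal t) b) s *\<^sub>R (f s * cnj (\<kappa> s))))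
          \<le> (if t < s \<and> s \<in> D then ennreal (cmod (f' s) * cmod (\<kappa>' s)) else 0)"
        using kappa_AE
      proof eventually_elim
        case (elim s)
        then show ?case
          by (cases "s \<in> ivl (ereal t) b") (auto simp: mem_ivl_cut[OF t] f'_def \<kappa>'_def norm_mult)
      qed
    qed
    finally show ?thesis .
  qed
  have "ennreal ((L2norm (c N) b (Tfun a b \<kappa> \<phi> f))\<^sup>2)
      = (\<integral>\<^sup>+t. indicator (ivl (c N) b) t * ennreal ((cmod (indicator (ivl a b) t *\<^sub>R Tfun a b \<kappa> \<phi> f t))\<^sup>2) \<partial>lborel)"
    by (rule nn_integral_L2norm[OF L2_subinterval[OF Tf c_ge order_refl] sub, symmetric])
  also have "\<dots> \<le> (\<integral>\<^sup>+t. indicator (\<Union>n\<in>{N..}. E n) t * (ennreal ((cmod (\<phi>' t))\<^sup>2) * (H t)\<^sup>2) \<partial>lborel)"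
  proof (rule nn_integral_mono_AE)
    show "AE t in lborel. indicator (ivl (c N) b) t * ennreal ((cmod (indicator (ivl a b) t *\<^sub>R Tfun a b \<kappa> \<phi> f t))\<^sup>2)
      \<le> indicator (\<Union>n\<in>{N..}. E n) t * (ennreal ((cmod (\<phi>' t))\<^sup>2) * (H t)\<^sup>2)"
      using AE_not_c
    proof eventually_elim
      case (elim t)
      show ?case
      proof (cases "t \<in> ivl (c N) b")
        case True
        then have t: "t \<in> ivl a b" using sub by blast
        have "ennreal ((cmod (Tfun a b \<kappa> \<phi> f t))\<^sup>2)
            = ennreal ((cmod (\<phi>' t))\<^sup>2) * (ennreal (cmod (L2inner (ereal t) b f \<kappa>)))\<^sup>2"
          using t by (simp add: Tfun_eq norm_mult power_mult_distrib ennreal_mult ennreal_power \<phi>'_def)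
        also have "\<dots> \<le> ennreal ((cmod (\<phi>' t))\<^sup>2) * (H t)\<^sup>2"
          by (intro mult_left_mono power_mono H t) auto
        finally have le: "ennreal ((cmod (Tfun a b \<kappa> \<phi> f t))\<^sup>2) \<le> ennreal ((cmod (\<phi>' t))\<^sup>2) * (H t)\<^sup>2" .
        show ?thesis
        proof (cases "t \<in> D")
          case True
          then obtain n where n: "t \<in> E n" by (auto simp: D_def)
          have "N \<le> n"
          proof (rule ccontr)
            assume "\<not> N \<le> n"
            then have "c (Suc n) \<le> c N" by (subst strict_mono_less_eq[OF c_mono]) simp
            with n \<open>t \<in> ivl (c N) b\<close> show False by (auto simp: E_def mem_ivl)
          qed
          with n le t show ?thesis by (auto simp: indicator_def)
        next
          case False
          \<comment> \<open>A point beyond all \<open>c n\<close> has no point of \<open>D\<close>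
            to its right, so \<open>H t = 0\<close> and the image vanishes there too.\<close>
          then have *: "c n < ereal t" for n using not_in_D[OF t _ elim] by blast
          have nD: "s \<notin> D" if "t < s" for s
          proof
            assume "s \<in> D"
            then obtain n where "ereal s < c (Suc n)" by (auto simp: D_def E_def mem_ivl)
            with *[of "Suc n"] that show False by (metis less_asym less_ereal.simps(1) order.strict_trans)
          qed
          have "H t = (\<integral>\<^sup>+(s::real). 0 \<partial>lborel)"
            unfolding H_def by (intro nn_integral_cong) (use nD in auto)
          then have "H t = 0" by simp
          with le t show ?thesis by simp
        qed
      qed simp
    qed
  qed
  also have "\<dots> \<le> ennreal (13 * \<delta> * (L2norm a b f)\<^sup>2)"
    unfolding H_def f'_def \<kappa>'_def \<phi>'_def by (rule hardy_tail[OF f small])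
  finally show ?thesis using delta by (subst (asm) ennreal_le_iff) auto
qed

text \<open>Along a subsequence the inner integrals converge at every point. Up to
  \<open>c N\<close> dominated convergence makes the images Cauchy; beyond \<open>c N\<close> the
  bound of \<open>Tfun_tail\<close>, applied to differences, is small for large
  \<open>N\<close>.\<close>

lemma compact_of_omega:
  assumes lim: "(\<lambda>n. kn n * pn n) \<longlonglongrightarrow> 0"
  shows "compact_op a b (T_graph a b \<kappa> \<phi>)"
proof -
  let ?T = "Tfun a b \<kappa> \<phi>"
  have "\<exists>r::nat \<Rightarrow> nat. strict_mono r \<and> L2_Cauchy a b (\<lambda>n. u (r n))"
    if fu: "\<forall>n. (f n, u n) \<in> T_graph a b \<kappa> \<phi> \<and> L2norm a b (f n) \<le> B" for f u :: "nat \<Rightarrow> real \<Rightarrow> complex" and B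
  proof -
    have fL: "f n \<in> L2 a b" and uL: "u n \<in> L2 a b" and uT: "u n = ?T (f n)" and B: "L2norm a b (f n) \<le> B" for n
      using fu unfolding mem_T_graph by blast+
    have B0: "0 \<le> B" using B[of 0] L2norm_nonneg order_trans by blast
    let ?F = "\<lambda>n t. L2inner (ereal t) b (f n) \<kappa>"
    obtain r where r: "strict_mono r" "\<And>t. t \<in> ivl a b \<Longrightarrow> convergent (\<lambda>n. ?F (r n) t)"
      by (rule L2inner_cut_convergent_subseq[OF kappa, of f B]) (use fL B in blast)+
    define G where "G t = lim (\<lambda>n. ?F (r n) t)" for t
    have FG: "(\<lambda>n. ?F (r n) t) \<longlonglongrightarrow> G t" if "t \<in> ivl a b" for t
      using r(2)[OF that] by (simp add: G_def convergent_LIMSEQ_iff)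
    have Fb: "cmod (?F n t) \<le> B * L2norm a b \<kappa>" if "t \<in> ivl a b" for n t
      using order_trans[OF L2inner_cut_le(1)[OF fL kappa that, of n] mult_right_mono[OF B[of n] L2norm_nonneg]] .
    have Gb: "cmod (G t) \<le> B * L2norm a b \<kappa>" if "t \<in> ivl a b" for t
      using Fb[OF that] by (intro LIMSEQ_le_const2[OF tendsto_norm[OF FG[OF that]]]) auto
    define g where "g n t = \<phi> t * (?F (r n) t - G t)" for n t
    have g_meas: "set_borel_measurable lborel (ivl a b) (g n)" for n
    proof -
      have m: "set_borel_measurable lborel (ivl a b) (\<lambda>t. \<phi> t * ?F n t)" for n
        by (rule set_borel_measurable_mult_cut(1)[OF fL kappa phi_meas])
      \<comment> \<open>The limit inherits measurability; the indicator forces convergence off the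
        interval as well.\<close>
      have "(\<lambda>t. indicat_real (ivl a b) t *\<^sub>R (\<phi> t * G t)) \<in> borel_measurable lborel"
      proof (rule borel_measurable_LIMSEQ_metric)
        show "(\<lambda>t. indicat_real (ivl a b) t *\<^sub>R (\<phi> t * ?F (r n) t)) \<in> borel_measurable lborel" for n
          using m by (simp add: set_borel_measurable_def)
        show "(\<lambda>n. indicat_real (ivl a b) t *\<^sub>R (\<phi> t * ?F (r n) t)) \<longlonglongrightarrow> indicat_real (ivl a b) t *\<^sub>R (\<phi> t * G t)" for t
        proof (cases "t \<in> ivl a b")
          case True
          then show ?thesis by (intro tendsto_intros FG)
        qed simp
      qed
      then have "(\<lambda>t. indicat_real (ivl a b) t *\<^sub>R (\<phi> t * ?F (r n) t) - indicat_real (ivl a b) t *\<^sub>R (\<phi> t * G t)) \<in> borel_measurable lborel"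
        using m[of "r n"] unfolding set_borel_measurable_def by (rule borel_measurable_diff[rotated])
      then show ?thesis
        unfolding set_borel_measurable_def g_def by (simp add: right_diff_distrib scaleR_diff_right)
    qed
    have g_bound: "cmod (g n t) \<le> 2 * (B * L2norm a b \<kappa>) * cmod (\<phi> t)" if "t \<in> ivl a b" for n t
    proof -
      have "cmod (?F (r n) t - G t) \<le> 2 * (B * L2norm a b \<kappa>)"
        using norm_triangle_ineq4[of "?F (r n) t" "G t"] Fb[OF that, of "r n"] Gb[OF that] by linarith
      then have "cmod (\<phi> t) * cmod (?F (r n) t - G t) \<le> cmod (\<phi> t) * (2 * (B * L2norm a b \<kappa>))"
        by (rule mult_left_mono) simp
      then show ?thesis by (simp add: g_def norm_mult mult.commute)
    qed
    have "L2_Cauchy a b (\<lambda>n. u (r n))"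
      unfolding L2_Cauchy_def
    proof (intro allI impI)
      fix e :: real assume e: "e > 0"
      \<comment> \<open>Here \<open>104 = 2 * 13 * 4\<close>: 13 comes from
        \<open>Tfun_tail\<close>, 4 from the bound \<open>2 * B\<close> on differences, and 2 leaves
        \<open>e\<^sup>2 / 2\<close> for the tail. The summand 1 covers
        \<open>B = 0\<close>.\<close>
      define \<delta> where "\<delta> = e\<^sup>2 / 104 / (B\<^sup>2 + 1)"
      have "\<delta> > 0" using e by (simp add: \<delta>_def add_nonneg_pos)
      have "(\<lambda>n. (kn n * pn n)\<^sup>2) \<longlonglongrightarrow> 0\<^sup>2" by (intro tendsto_power lim)
      then have "(\<lambda>n. (kn n * pn n)\<^sup>2) \<longlonglongrightarrow> 0" by simp
      from order_tendstoD(2)[OF this \<open>\<delta> > 0\<close>] obtain N0 where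
        N0: "\<And>n. n \<ge> N0 \<Longrightarrow> (kn n * pn n)\<^sup>2 < \<delta>" by (auto simp: eventually_sequentially)
      \<comment> \<open>A successor index makes \<open>c N\<close> a real number, whereas
        \<open>c 0\<close> may be infinite.\<close>
      define N where "N = Suc N0"
      have small: "(kn n * pn n)\<^sup>2 \<le> \<delta>" if "n \<ge> N" for n
        using N0[of n] that by (simp add: N_def)
      obtain d where d: "c N = ereal d" using c_real[of N0] by (auto simp: N_def)
      have ad: "a \<le> ereal d" "ereal d \<le> b" using c_ge[of N] c_lt[of N] by (auto simp: d)
      have phid: "\<phi> \<in> L2 a (ereal d)" using phi_c[of N] by (simp add: d)
      have subd: "ivl a (ereal d) \<subseteq> ivl a b" using ad by (intro ivl_mono) auto
      have gL: "g n \<in> L2 a (ereal d)" for n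
        using g_bound subd
        by (intro L2_bound[OF phid, where C="2 * (B * L2norm a b \<kappa>)"]
            set_borel_measurable_subset_borel[OF g_meas]) auto
      have "(\<lambda>n. L2norm a (ereal d) (g n)) \<longlonglongrightarrow> 0"
      proof (rule L2norm_dominated_convergence[OF phid gL])
        show "cmod (g n x) \<le> 2 * (B * L2norm a b \<kappa>) * cmod (\<phi> x)" if "x \<in> ivl a (ereal d)" for n x
          using g_bound that subd by blast
        show "(\<lambda>n. g n x) \<longlonglongrightarrow> 0" if "x \<in> ivl a (ereal d)" for x
        proof -
          have "(\<lambda>n. \<phi> x * (?F (r n) x - G x)) \<longlonglongrightarrow> \<phi> x * (G x - G x)"
            using that subd by (intro tendsto_intros FG) auto
          then show ?thesis by (simp add: g_def)
        qed
      qed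
      from order_tendstoD(2)[OF this, of "e / 4"] e obtain M where
        M: "\<And>n. n \<ge> M \<Longrightarrow> L2norm a (ereal d) (g n) < e / 4" by (auto simp: eventually_sequentially)
      show "\<exists>N. \<forall>m\<ge>N. \<forall>n\<ge>N. L2norm a b (\<lambda>x. u (r m) x - u (r n) x) < e"
      proof (intro exI allI impI)
        fix m n assume mn: "m \<ge> M" "n \<ge> M"
        define y where "y = (\<lambda>x. u (r m) x - u (r n) x)"
        define v where "v = (\<lambda>x. f (r m) x - f (r n) x)"
        have yL: "y \<in> L2 a b" and vL: "v \<in> L2 a b" unfolding y_def v_def by (intro L2_diff uL fL)+
        have yT: "y x = ?T v x" if "x \<in> ivl a b" for x
          unfolding y_def v_def uT using Tfun_diff[OF fL fL kappa that] by simp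
        have TvL: "?T v \<in> L2 a b" using yL L2_cong[of a b y "?T v"] yT by blast
        \<comment> \<open>The limit \<open>G\<close> cancels in the difference of \<open>g m\<close>
          and \<open>g n\<close>.\<close>
        have "L2norm a (ereal d) y = L2norm a (ereal d) (\<lambda>x. g m x - g n x)"
          unfolding y_def uT g_def Tfun_eq by (intro L2norm_cong) (simp add: algebra_simps)
        also have "\<dots> \<le> L2norm a (ereal d) (g m) + L2norm a (ereal d) (g n)"
          by (rule L2norm_triangle_diff[OF gL gL])
        also have "\<dots> \<le> e / 2" using M[OF mn(1)] M[OF mn(2)] by simp
        finally have "(L2norm a (ereal d) y)\<^sup>2 \<le> (e / 2)\<^sup>2" by (intro power_mono) auto
        moreover have "(L2norm (ereal d) b y)\<^sup>2 \<le> e\<^sup>2 / 2"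
        proof -
          have "L2norm (ereal d) b y = L2norm (c N) b (?T v)"
            unfolding d[symmetric] using ivl_mono[OF c_ge order_refl, of N b] by (intro L2norm_cong yT) auto
          then have "(L2norm (ereal d) b y)\<^sup>2 \<le> 13 * \<delta> * (L2norm a b v)\<^sup>2"
            using Tfun_tail[OF vL TvL small] by simp
          also have "\<dots> \<le> 13 * \<delta> * (2 * B)\<^sup>2"
            using L2norm_triangle_diff[OF fL fL, of "r m" "r n"] B[of "r m"] B[of "r n"] \<open>\<delta> > 0\<close>
            by (intro mult_left_mono power_mono) (auto simp: v_def)
          also have "\<dots> = 52 * (\<delta> * B\<^sup>2)" by (simp add: power_mult_distrib)
          also have "\<dots> \<le> 52 * (\<delta> * (B\<^sup>2 + 1))" using \<open>\<delta> > 0\<close> by (intro mult_left_mono) auto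
          also have "\<delta> * (B\<^sup>2 + 1) = e\<^sup>2 / 104"
          proof (rule iffD1[OF nonzero_eq_divide_eq \<delta>_def])
            show "B\<^sup>2 + 1 \<noteq> 0" using zero_le_power2[of B] by linarith
          qed
          finally show ?thesis by simp
        qed
        \<comment> \<open>The two parts together give \<open>3/4 * e\<^sup>2\<close>.\<close>
        moreover have "(e / 2)\<^sup>2 + e\<^sup>2 / 2 < e\<^sup>2"
          using e by (simp add: power2_eq_square field_simps)
        ultimately have "(L2norm a b y)\<^sup>2 < e\<^sup>2"
          using L2norm_split[OF yL ad] by linarith
        then have "L2norm a b y < e" using e by (simp add: power_less_imp_less_base)
        then show "L2norm a b (\<lambda>x. u (r m) x - u (r n) x) < e" by (simp add: y_def)
      qed
    qed
    with r(1) show ?thesis by blast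
  qed
  moreover have "T_graph a b \<kappa> \<phi> \<subseteq> L2 a b \<times> L2 a b" by (auto simp: T_graph_def)
  ultimately show ?thesis unfolding compact_op_iff by blast
qed

end

section \<open>Compactness of the operator and of its real part in terms of \<omega>\<close>

theorem theorem3p1:
  fixes a b :: ereal and \<kappa> \<phi> :: "real \<Rightarrow> complex" and c :: "nat \<Rightarrow> ereal"
  assumes ab: "a < b"
    and kappa: "\<kappa> \<in> L2 a b"
    and phi_meas: "set_borel_measurable lborel (ivl a b) \<phi>"
    and phi_loc: "\<And>d. a < ereal d \<Longrightarrow> ereal d < b \<Longrightarrow>
                    (\<lambda>x. indicator {x. a < ereal x \<and> x < d} x * \<phi> x) \<in> L2 a b"
    and c0: "c 0 = a"
    and c_mono: "strict_mono c"
    and c_lt: "\<And>n. c n < b"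
    and c_norm: "\<And>n. (L2norm a b (\<lambda>x. indicator {x. c n < ereal x \<and> ereal x < b} x * \<kappa> x))\<^sup>2
                     = (1/2) ^ n * (L2norm a b \<kappa>)\<^sup>2"
  defines "\<omega> \<equiv> (\<lambda>n. L2norm a b (\<lambda>x. indicator {x. c (n - 1) < ereal x \<and> ereal x < c n} x * \<kappa> x) *
                  L2norm a b (\<lambda>x. indicator {x. c (n - 1) < ereal x \<and> ereal x < c n} x * \<phi> x))"
  shows "(compact_op a b (T_graph a b \<kappa> \<phi>) \<longrightarrow> compact_op a b (Re_graph a b (T_graph a b \<kappa> \<phi>)))
       \<and> (compact_op a b (Re_graph a b (T_graph a b \<kappa> \<phi>)) \<longrightarrow> (\<lambda>n. \<omega> (Suc n)) \<longlonglongrightarrow> 0)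
       \<and> ((\<lambda>n. \<omega> (Suc n)) \<longlonglongrightarrow> 0 \<longrightarrow> compact_op a b (T_graph a b \<kappa> \<phi>))"
proof -
  \<comment> \<open>The hypotheses with cut-offs on \<open>(a,b)\<close> are translated into the
    subinterval form of \<open>dyadic_partition\<close>.\<close>
  have phi_loc': "\<phi> \<in> L2 a (ereal d)" if "a < ereal d" "ereal d < b" for d
    using phi_loc[OF that] that ivl_mono[of a a "ereal d" b]
    by (subst (asm) L2_indicator_iff[where c=a and d="ereal d"]) (auto simp: mem_ivl)
  have "a \<le> c n" for n using strict_mono_less_eq[OF c_mono, of 0 n] by (simp add: c0)
  then have "L2norm a b (\<lambda>x. indicator (ivl (c n) b) x * \<kappa> x) = L2norm (c n) b \<kappa>" for n
    using ivl_mono[of a "c n" b b] by (intro L2norm_indicator) auto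
  then have "(L2norm (c n) b \<kappa>)\<^sup>2 = (1/2) ^ n * (L2norm a b \<kappa>)\<^sup>2" for n
    using c_norm[of n] by (simp add: ivl_def)
  then interpret dyadic_partition a b \<kappa> \<phi> c
    by unfold_locales (use kappa phi_meas phi_loc' c0 c_mono c_lt in auto)
  \<comment> \<open>At \<open>Suc n\<close> the natural number subtraction in \<omega> returns
    \<open>n\<close>, so the interval is the block \<open>E n\<close>.\<close>
  have "\<omega> (Suc n) = kn n * pn n" for n
    using L2norm_E[of n] by (simp add: \<omega>_def kn_def pn_def E_def ivl_def[symmetric])
  then show ?thesis
    using Re_compact_of_compact[OF ab kappa phi_meas phi_loc'] omega_tendsto_0 compact_of_omega by simp
qed

end
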